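(* Let $f$ be a point-map and let $\mathcal P_0$ be the Palm distribution of a stationary point process on $\mathbb R^d$ with non-degenerate intensity. Let $\mathcal P_0^{f,n}=(\theta_f^n)_*\mathcal P_0$ and let $A_{\mathcal P_0}=\{\mathcal P_0^{f,n}:n\ge0\}$ be the orbit of $\mathcal P_0$. A necessary and sufficient condition for the set $A_{\mathcal P_0}$ to be relatively compact in $\mathbf M^1(\mathbf N^0)$ is that for all bounded Borel subsets $B$ of $\mathbb R^d$, $$\lim_{r\to\infty}\limsup_{n\to\infty}\mathcal P_0^{f,n}[\{\phi\in\mathbf N^0:\phi(B)>r\}]=0.$$
   Context: $\mathbf N$ is the space of locally finite counting measures on $\mathbb R^d$ (not necessarily simple; identified with multisets), with the vague topology and its Borel $\sigma$-field. $\overline\phi$ is the support of $\phi$; $x\in\phi$ means $\phi(\{x\})>0$. $\mathbf N^0=\{\phi\in\mathbf N:0\in\phi\}$. For $t\in\mathbb R^d$, $\theta_t\phi(B)=\phi(B+t)$ (translation by $-t$). $\mathbf M^1(\mathbf N^0)$ is the set of probability measures on $\mathbf N^0$ with the topology of weak convergence. Point-map: a measurable $f:\mathbf N^0\to\mathbb R^d$ with $f(\phi)=f(\overline\phi)\in\overline\phi$ for all $\phi$. For $\phi\in\mathbf N^0$, $\theta_f(\phi)=\theta_{f(\phi)}\phi\in\mathbf N^0$, with $n$-th iterate $\theta_f^n$. Stationary point process: $(\theta_t)_{t\in\mathbb R^d}$ is a measurable flow on a probability space $(\Omega,\mathcal F,\mathbb P)$ leaving $\mathbb P$ invariant, and $\Phi:\Omega\to\mathbf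 N$ is measurable with $\Phi\circ\theta_t=\theta_t\circ\Phi$. Its intensity $\lambda$ is the mean number of points (with multiplicity) in the unit cube; it is non-degenerate if $0<\lambda<\infty$. The Palm probability is $\mathbb P_\Phi[A]=\frac1{\lambda|B|}\int_\Omega\int_B\mathbf 1\{\theta_t\omega\in A\}\,\Phi(\omega,dt)\,\mathbb P[d\omega]$ for any Borel $B$ with Lebesgue measure $0<|B|<\infty$. $\mathcal P_0=\Phi_*\mathbb P_\Phi$ is the Palm distribution, a probability on $\mathbf N^0$. Here $h_*\mu(A)=\mu(h^{-1}A)$. *)

theory Defs
  imports "HOL-Probability.Probability"
begin

text \<open>The space \<open>\<real>\<^sup>d\<close>, for arbitrary \<open>d \<ge> 1\<close>, is a type of class \<^class>\<open>euclidean_space\<close>.\<close>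

section \<open>Borel sets and probability measures on an abstract topological space\<close>

definition borel_of :: "'b topology \<Rightarrow> 'b measure" where
  "borel_of X = sigma (topspace X) {U. openin X U}"

definition prob_measures :: "'b topology \<Rightarrow> 'b measure set" where
  "prob_measures X = {\<mu>. sets \<mu> = sets (borel_of X) \<and> prob_space \<mu>}"

text \<open>The topology of weak convergence: the coarsest topology on \<^term>\<open>prob_measures X\<close> making
  \<open>\<mu> \<mapsto> \<integral> h d\<mu>\<close> continuous for every bounded continuous \<open>h\<close>.
  The choice \<open>h = 0\<close>, \<open>U = UNIV\<close> shows that its carrier is all of \<^term>\<open>prob_measures X\<close>.\<close>
definition weak_topology :: "'b topology \<Rightarrow> 'b measure topology" where
  "weak_topology X = topology_generated_by
     {{\<mu> \<in> prob_measures X. (\<integral>x. h x \<partial>\<mu>) \<in> U} | h U.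
        continuous_map X euclideanreal h \<and> bounded (h ` topspace X) \<and> open U}"

definition relatively_compactin :: "'b topology \<Rightarrow> 'b set \<Rightarrow> bool" where
  "relatively_compactin X A \<longleftrightarrow> A \<subseteq> topspace X \<and> compactin X (X closure_of A)"

section \<open>Locally finite counting measures\<close>

definition counting_measures :: "'a::euclidean_space measure set" where
  "counting_measures =
     {\<phi>. sets \<phi> = sets borel \<and>
         (\<forall>B\<in>sets borel. bounded B \<longrightarrow> (\<exists>k::nat. emeasure \<phi> B = of_nat k))}"

text \<open>The coarsest topology making \<open>\<phi> \<mapsto> \<integral> g d\<phi>\<close> continuous for every continuous \<open>g\<close> with
  compact support.\<close>
definition vague_topology :: "'a::euclidean_space measure topology" where
  "vague_topology = topology_generated_by
     {{\<phi> \<in> counting_measures. (\<integral>x. g x \<partial>\<phi>) \<in> U} | (g :: 'a \<Rightarrow> real) U.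
        continuous_on UNIV g \<and> compact (closure {x. g x \<noteq> 0}) \<and> open U}"

definition counting_measures0 :: "'a::euclidean_space measure set" where
  "counting_measures0 = {\<phi> \<in> counting_measures. emeasure \<phi> {0} > 0}"

definition vague_topology0 :: "'a::euclidean_space measure topology" where
  "vague_topology0 = subtopology vague_topology counting_measures0"

text \<open>\<open>shift t \<phi> B = \<phi> (B + t)\<close>\<close>
definition shift :: "'a::euclidean_space \<Rightarrow> 'a measure \<Rightarrow> 'a measure" where
  "shift t \<phi> = distr \<phi> borel (\<lambda>x. x - t)"

definition support :: "'a::euclidean_space measure \<Rightarrow> 'a set" where
  "support \<phi> = {x. \<forall>U. open U \<and> x \<in> U \<longrightarrow> emeasure \<phi> U > 0}"

text \<open>The support identified with a simple counting measure:
  \<open>simple_version \<phi> B\<close> is the number of points of \<open>support \<phi> \<inter> B\<close>.\<close>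
definition simple_version :: "'a::euclidean_space measure \<Rightarrow> 'a measure" where
  "simple_version \<phi> = distr (count_space (support \<phi>)) borel (\<lambda>x. x)"

section \<open>Point-maps\<close>

definition point_map :: "('a::euclidean_space measure \<Rightarrow> 'a) \<Rightarrow> bool" where
  "point_map f \<longleftrightarrow>
     f \<in> measurable (borel_of vague_topology0) borel \<and>
     (\<forall>\<phi>\<in>counting_measures0. f \<phi> = f (simple_version \<phi>) \<and> f \<phi> \<in> support \<phi>)"

definition point_map_shift ::
  "('a::euclidean_space measure \<Rightarrow> 'a) \<Rightarrow> 'a measure \<Rightarrow> 'a measure" where
  "point_map_shift f \<phi> = shift (f \<phi>) \<phi>"

section \<open>Stationary point processes and Palm probabilities\<close>

locale stationary_point_process = prob_space P
  for P :: "'w measure"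
    and \<theta> :: "'a::euclidean_space \<Rightarrow> 'w \<Rightarrow> 'w"
    and \<Phi> :: "'w \<Rightarrow> 'a measure" +
  assumes flow_measurable: "(\<lambda>(t, \<omega>). \<theta> t \<omega>) \<in> measurable (borel \<Otimes>\<^sub>M P) P"
    and flow_zero: "\<And>\<omega>. \<omega> \<in> space P \<Longrightarrow> \<theta> 0 \<omega> = \<omega>"
    and flow_add: "\<And>s t \<omega>. \<omega> \<in> space P \<Longrightarrow> \<theta> (s + t) \<omega> = \<theta> s (\<theta> t \<omega>)"
    and flow_invariant: "\<And>t. distr P P (\<theta> t) = P"
    and process_measurable: "\<Phi> \<in> measurable P (borel_of vague_topology)"
    and process_covariant: "\<And>t \<omega>. \<omega> \<in> space P \<Longrightarrow> \<Phi> (\<theta> t \<omega>) = shift t (\<Phi> \<omega>)"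

definition intensity :: "'w measure \<Rightarrow> ('w \<Rightarrow> 'a::euclidean_space measure) \<Rightarrow> ennreal" where
  "intensity P \<Phi> = (\<integral>\<^sup>+\<omega>. emeasure (\<Phi> \<omega>) (cbox 0 One) \<partial>P)"

text \<open>\<open>Q\<close> is the Palm probability of \<open>\<Phi>\<close>. As \<open>Q\<close> has the same \<open>\<sigma>\<close>-field as \<open>P\<close>, the formula,
  for any one admissible \<open>B\<close>, determines it.\<close>
definition palm_probability ::
  "'w measure \<Rightarrow> ('a::euclidean_space \<Rightarrow> 'w \<Rightarrow> 'w) \<Rightarrow> ('w \<Rightarrow> 'a measure) \<Rightarrow> 'w measure \<Rightarrow> bool" where
  "palm_probability P \<theta> \<Phi> Q \<longleftrightarrow>
     sets Q = sets P \<and>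
     (\<forall>A\<in>sets P. \<forall>B\<in>sets borel. 0 < emeasure lborel B \<and> emeasure lborel B < \<infinity> \<longrightarrow>
        emeasure Q A =
          (\<integral>\<^sup>+\<omega>. (\<integral>\<^sup>+t\<in>B. indicator A (\<theta> t \<omega>) \<partial>\<Phi> \<omega>) \<partial>P) / (intensity P \<Phi> * emeasure lborel B))"

text \<open>The law of \<open>\<Phi>\<close> under the Palm probability \<open>Q\<close> is carried by \<^term>\<open>counting_measures0\<close>
  and is regarded as a measure on that space.\<close>
definition palm_distribution ::
  "('w \<Rightarrow> 'a::euclidean_space measure) \<Rightarrow> 'w measure \<Rightarrow> 'a measure measure" where
  "palm_distribution \<Phi> Q = restrict_space (distr Q (borel_of vague_topology) \<Phi>) counting_measures0"

definition iterated_law ::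
  "('a::euclidean_space measure \<Rightarrow> 'a) \<Rightarrow> 'a measure measure \<Rightarrow> nat \<Rightarrow> 'a measure measure" where
  "iterated_law f P0 n = distr P0 (borel_of vague_topology0) (point_map_shift f ^^ n)"

end

theory Submission
  imports Defs
begin

text \<open>
  Why the theorem holds. The statement is an instance of the criterion that a family of laws of
  point processes is relatively compact as soon as its point counts in bounded sets are tight. The
  point-map and the Palm distribution only have to supply a sequence of probability measures on
  configurations with a point at the origin: a point-shift is measurable, and it maps such configurations
  to such configurations because every point of the support of a counting measure is an atom; the
  Palm distribution is carried by them, because for every \<open>\<omega>\<close> almost all points of \<open>\<Phi> \<omega>\<close> are
  atoms (\<open>iterated_law_prob_measure\<close>, \<open>palm_distribution_prob_measure\<close>). A single law has tight
  counts, so the upper limit over \<open>n\<close> in the condition can be exchanged for a supremum over \<open>n\<close>.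

  Necessity. Let \<open>g\<close> be a continuous function with compact support and \<open>g \<ge> 1\<close> on \<open>B\<close>. The functions
  \<open>h\<^sub>k \<phi> = max 0 (min 1 (\<integral> g d\<phi> - k))\<close> are bounded and continuous and decrease to \<open>0\<close>. Their integrals
  are continuous functions of the law that decrease to \<open>0\<close>, hence uniformly so on a compact set of
  laws by Dini's theorem, and \<open>h\<^sub>k \<phi> = 1\<close> when \<open>\<phi> B > k + 1\<close>.

  Sufficiency. This is Prokhorov's theorem (\<open>tight_imp_relatively_compact\<close>), proved without metrizing
  the weak topology. A law is sent to the family of its integrals against all bounded continuous
  functions, a point of a product of compact intervals. A limit point of the images of the laws is a
  positive linear functional, and tightness with Dini's theorem makes it continuous along decreasing
  sequences. A Daniell-type representation theorem (\<open>daniell_functional.representation\<close>) then turns it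
  into a probability measure, so no limit point is missing from the set of all laws.

  Both the representation theorem and the tightness need facts on the vague topology: open sets must
  be cozero sets of continuous functions, and there must be enough compact sets. They come from one
  parametrization. Describe a configuration by the number \<open>r k\<close> of its points in each annulus
  \<open>k \<le> |x| < k + 1\<close> and by a list of these points. The parameters range over a subset of a product of
  Euclidean spaces and discrete spaces, and the configuration depends continuously on them. As the
  parameter space has a countable base, the vague topology is hereditarily Lindelof
  (\<open>vague_hereditarily_Lindelof\<close>), so every vaguely open set is a countable union of finite
  intersections of sets \<open>{\<phi>. \<integral> g d\<phi> \<in> U}\<close>; this gives the cozero property and reduces measurability to
  the maps \<open>\<phi> \<mapsto> \<integral> g d\<phi>\<close>. Bounding the numbers \<open>r k\<close> gives a compact set of parameters, hence
  a compact set of configurations (\<open>compactin_bounded_configs\<close>).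
\<close>

section \<open>Bounded continuous functions and Borel measures on a topology\<close>

definition bcont :: "'b topology \<Rightarrow> ('b \<Rightarrow> real) set" where
  "bcont X = {h. continuous_map X euclideanreal h \<and> bounded (h ` topspace X)}"

text \<open>The sets \<open>{e > 0}\<close> for bounded continuous \<open>e\<close>. Continuity of \<open>e\<close> makes the truncated
  multiples \<open>min 1 (n e)\<close> bounded continuous functions that increase to the indicator of the
  set, and this is how open sets are reached by integrals of continuous functions.\<close>
definition cozero_in :: "'b topology \<Rightarrow> 'b set \<Rightarrow> bool" where
  "cozero_in X G \<longleftrightarrow>
     (\<exists>e\<in>bcont X. (\<forall>x\<in>topspace X. 0 \<le> e x \<and> e x \<le> 1) \<and> G = {x\<in>topspace X. 0 < e x})"

definition cozero_space :: "'b topology \<Rightarrow> bool" where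
  "cozero_space X \<longleftrightarrow> (\<forall>G. openin X G \<longrightarrow> cozero_in X G)"

lemma space_borel_of [simp]: "space (borel_of X) = topspace X"
  by (simp add: borel_of_def space_measure_of_conv)

lemma sets_borel_of: "sets (borel_of X) = sigma_sets (topspace X) {U. openin X U}"
  unfolding borel_of_def by (rule sets_measure_of) (auto dest: openin_subset)

lemma openin_sets_borel_of: "openin X U \<Longrightarrow> U \<in> sets (borel_of X)"
  by (simp add: sets_borel_of sigma_sets.Basic)

lemma prob_measures_D:
  assumes "\<mu> \<in> prob_measures X"
  shows "sets \<mu> = sets (borel_of X)" "space \<mu> = topspace X" "prob_space \<mu>"
  using assms by (auto simp: prob_measures_def dest: sets_eq_imp_space_eq)

lemma continuous_map_borel_of:
  assumes "continuous_map X euclideanreal h"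
  shows "h \<in> borel_measurable (borel_of X)"
proof (rule borel_measurableI)
  fix S :: "real set" assume "open S"
  then have "openin X {x \<in> topspace X. h x \<in> S}"
    using assms by (simp add: continuous_map_def)
  moreover have "h -` S \<inter> space (borel_of X) = {x \<in> topspace X. h x \<in> S}" by auto
  ultimately show "h -` S \<inter> space (borel_of X) \<in> sets (borel_of X)"
    by (simp add: openin_sets_borel_of)
qed

lemma bcontE:
  assumes "h \<in> bcont X"
  obtains c where "0 < c" "\<And>x. x \<in> topspace X \<Longrightarrow> \<bar>h x\<bar> \<le> c"
  using assms unfolding bcont_def bounded_pos by auto

lemma bcontI:
  assumes "continuous_map X euclideanreal h" "\<And>x. x \<in> topspace X \<Longrightarrow> \<bar>h x\<bar> \<le> c"
  shows "h \<in> bcont X"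
  using assms unfolding bcont_def bounded_iff by auto

lemma bcont_continuous: "h \<in> bcont X \<Longrightarrow> continuous_map X euclideanreal h"
  by (simp add: bcont_def)

lemma openin_bcont_preimage:
  assumes "h \<in> bcont X" "open U"
  shows "openin X {x \<in> topspace X. h x \<in> U}"
  using assms by (auto simp: bcont_def continuous_map_def)

lemma bcont_const: "(\<lambda>_. c) \<in> bcont X"
  by (rule bcontI[where c="\<bar>c\<bar>"]) auto

lemma bcont_add:
  assumes "h \<in> bcont X" "g \<in> bcont X" shows "(\<lambda>x. h x + g x) \<in> bcont X"
proof -
  obtain a b where "\<And>x. x \<in> topspace X \<Longrightarrow> \<bar>h x\<bar> \<le> a" "\<And>x. x \<in> topspace X \<Longrightarrow> \<bar>g x\<bar> \<le> b"
    using assms bcontE by metis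
  then show ?thesis
    using assms by (intro bcontI[where c="a + b"] continuous_map_add)
      (auto simp: bcont_def intro: order_trans[OF abs_triangle_ineq] add_mono)
qed

lemma bcont_mult:
  assumes "h \<in> bcont X" "g \<in> bcont X" shows "(\<lambda>x. h x * g x) \<in> bcont X"
proof -
  obtain a b where "0 < a" "\<And>x. x \<in> topspace X \<Longrightarrow> \<bar>h x\<bar> \<le> a" "\<And>x. x \<in> topspace X \<Longrightarrow> \<bar>g x\<bar> \<le> b"
    using assms bcontE by metis
  then show ?thesis
    using assms by (intro bcontI[where c="a * b"] continuous_map_real_mult)
      (auto simp: bcont_def abs_mult intro!: mult_mono)
qed

lemma bcont_cmult: "h \<in> bcont X \<Longrightarrow> (\<lambda>x. c * h x) \<in> bcont X"
  by (intro bcont_mult bcont_const)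

lemma bcont_diff:
  assumes "h \<in> bcont X" "g \<in> bcont X" shows "(\<lambda>x. h x - g x) \<in> bcont X"
  using bcont_add[OF assms(1) bcont_cmult[OF assms(2), of "-1"]] by simp

lemma bcont_max:
  assumes "h \<in> bcont X" "g \<in> bcont X" shows "(\<lambda>x. max (h x) (g x)) \<in> bcont X"
proof -
  obtain a b where "0 < a" "\<And>x. x \<in> topspace X \<Longrightarrow> \<bar>h x\<bar> \<le> a" "\<And>x. x \<in> topspace X \<Longrightarrow> \<bar>g x\<bar> \<le> b"
    using assms bcontE by metis
  then have "\<And>x. x \<in> topspace X \<Longrightarrow> \<bar>max (h x) (g x)\<bar> \<le> max a b"
    by (smt (verit))
  then show ?thesis
    using assms by (intro bcontI[where c="max a b"] continuous_map_real_max) (auto simp: bcont_def)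
qed

lemma bcont_min:
  assumes "h \<in> bcont X" "g \<in> bcont X" shows "(\<lambda>x. min (h x) (g x)) \<in> bcont X"
proof -
  have "(\<lambda>x. -1 * max (-1 * h x) (-1 * g x)) \<in> bcont X"
    by (intro bcont_cmult bcont_max assms)
  moreover have "(\<lambda>x. -1 * max (-1 * h x) (-1 * g x)) = (\<lambda>x. min (h x) (g x))"
    by (auto simp: fun_eq_iff)
  ultimately show ?thesis by simp
qed

lemma bcont_sum:
  assumes "\<And>i. i \<in> I \<Longrightarrow> h i \<in> bcont X" shows "(\<lambda>x. \<Sum>i\<in>I. h i x) \<in> bcont X"
  using assms
proof (induction I rule: infinite_finite_induct)
  case (insert i I)
  then show ?case by (simp add: bcont_add)
qed (simp_all add: bcont_const)

lemma bcont_integrable: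
  assumes "\<mu> \<in> prob_measures X" "h \<in> bcont X"
  shows "integrable \<mu> h"
proof -
  interpret prob_space \<mu> using assms prob_measures_D by blast
  obtain c where "\<And>x. x \<in> topspace X \<Longrightarrow> \<bar>h x\<bar> \<le> c" using assms bcontE by metis
  then show ?thesis
    using assms continuous_map_borel_of[of X h] prob_measures_D[OF assms(1)]
    by (intro integrable_const_bound[where B=c]) (auto simp: bcont_def measurable_def)
qed

section \<open>Monotone convergence on compact sets\<close>

text \<open>The sets \<open>{h n < e}\<close> are open, increase with \<open>n\<close> and cover \<open>K\<close>; finitely many of them, hence
  the largest of these, already cover \<open>K\<close>.\<close>
lemma Dini_compactin:
  fixes h :: "nat \<Rightarrow> 'b \<Rightarrow> real"
  assumes K: "compactin X K"
    and cont: "\<And>n. continuous_map X euclideanreal (h n)"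
    and dec: "\<And>n x. x \<in> K \<Longrightarrow> h (Suc n) x \<le> h n x"
    and lim: "\<And>x. x \<in> K \<Longrightarrow> (\<lambda>n. h n x) \<longlonglongrightarrow> 0"
    and e: "0 < e"
  shows "\<exists>N. \<forall>n\<ge>N. \<forall>x\<in>K. h n x < e"
proof -
  let ?U = "\<lambda>n. {x \<in> topspace X. h n x \<in> {..<e}}"
  have op: "openin X (?U n)" for n
    by (rule openin_continuous_map_preimage[OF cont]) auto
  have "K \<subseteq> \<Union>(range ?U)"
  proof
    fix x assume x: "x \<in> K"
    then have "\<exists>n. h n x < e"
      using order_tendstoD(2)[OF lim[OF x] e] by (auto simp: eventually_sequentially)
    with x K show "x \<in> \<Union>(range ?U)" by (auto dest: compactin_subset_topspace)
  qed
  then have "\<exists>\<F>. finite \<F> \<and> \<F> \<subseteq> range ?U \<and> K \<subseteq> \<Union>\<F>"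
    using op by (intro compactinD[OF K]) auto
  then obtain \<F> where F: "finite \<F>" "\<F> \<subseteq> range ?U" "K \<subseteq> \<Union>\<F>" by blast
  obtain I where I: "finite I" "\<F> = ?U ` I"
    using finite_subset_image[OF F(1,2)] by blast
  have anti: "h n x \<le> h m x" if "x \<in> K" "m \<le> n" for x m n
    using lift_Suc_antimono_le[of "\<lambda>n. h n x" m n] dec that by blast
  have "h n x < e" if n: "n \<ge> Max (insert 0 I)" and x: "x \<in> K" for n x
  proof -
    obtain i where "i \<in> I" "h i x < e" using F(3) I x by auto
    moreover have "i \<le> n" using n \<open>i \<in> I\<close> I(1) by (simp add: Max_ge_iff)
    ultimately show ?thesis using anti[OF x] by (meson le_less_trans)
  qed
  then show ?thesis by blast
qed

section \<open>The topology of weak convergence\<close>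

lemma topspace_weak_topology: "topspace (weak_topology X) = prob_measures X"
proof -
  have "bounded ((\<lambda>_. 0::real) ` topspace X)" unfolding bounded_iff by (intro exI[of _ 0]) simp
  then have "prob_measures X \<in> {{\<mu> \<in> prob_measures X. (\<integral>x. h x \<partial>\<mu>) \<in> U} | h U.
        continuous_map X euclideanreal h \<and> bounded (h ` topspace X) \<and> open U}"
    by (intro CollectI exI[of _ "\<lambda>_. 0"] exI[of _ UNIV] conjI) simp_all
  then show ?thesis unfolding weak_topology_def topology_generated_by_topspace by blast
qed

lemma continuous_integral_weak_topology:
  assumes "h \<in> bcont X"
  shows "continuous_map (weak_topology X) euclideanreal (\<lambda>\<mu>. \<integral>x. h x \<partial>\<mu>)"
  unfolding continuous_map_def
proof (intro conjI allI impI)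
  fix U :: "real set" assume "openin euclideanreal U"
  then have "{\<mu> \<in> prob_measures X. (\<integral>x. h x \<partial>\<mu>) \<in> U} \<in> {{\<mu> \<in> prob_measures X. (\<integral>x. h x \<partial>\<mu>) \<in> U} | h U.
        continuous_map X euclideanreal h \<and> bounded (h ` topspace X) \<and> open U}"
    using assms by (intro CollectI exI[of _ h] exI[of _ U] conjI) (simp_all add: bcont_def)
  then show "openin (weak_topology X) {\<mu> \<in> topspace (weak_topology X). (\<integral>x. h x \<partial>\<mu>) \<in> U}"
    unfolding topspace_weak_topology unfolding weak_topology_def
    by (rule topology_generated_by_Basis)
qed auto

text \<open>Dini's theorem is applied on the closure of \<open>A\<close>, where
  \<open>\<mu> \<mapsto> \<integral> h n d\<mu>\<close> is continuous by the definition of the topology and decreases to \<open>0\<close> by dominated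
  convergence.\<close>
lemma relatively_compact_imp_uniform_decreasing:
  fixes h :: "nat \<Rightarrow> 'b \<Rightarrow> real"
  assumes A: "relatively_compactin (weak_topology X) A"
    and h: "\<And>n. h n \<in> bcont X"
    and dec: "\<And>n x. x \<in> topspace X \<Longrightarrow> h (Suc n) x \<le> h n x"
    and lim: "\<And>x. x \<in> topspace X \<Longrightarrow> (\<lambda>n. h n x) \<longlonglongrightarrow> 0"
    and e: "0 < e"
  shows "\<exists>N. \<forall>n\<ge>N. \<forall>\<mu>\<in>A. (\<integral>x. h n x \<partial>\<mu>) < e"
proof -
  let ?K = "weak_topology X closure_of A"
  have K: "compactin (weak_topology X) ?K" and A': "A \<subseteq> topspace (weak_topology X)"
    using A by (auto simp: relatively_compactin_def)
  have "\<exists>N. \<forall>n\<ge>N. \<forall>\<mu>\<in>?K. (\<integral>x. h n x \<partial>\<mu>) < e"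
  proof (rule Dini_compactin[OF K _ _ _ e])
    show "continuous_map (weak_topology X) euclideanreal (\<lambda>\<mu>. \<integral>x. h n x \<partial>\<mu>)" for n
      by (rule continuous_integral_weak_topology[OF h])
    fix \<mu> assume "\<mu> \<in> ?K"
    then have \<mu>: "\<mu> \<in> prob_measures X"
      using compactin_subset_topspace[OF K] by (auto simp: topspace_weak_topology)
    note D = prob_measures_D[OF \<mu>]
    interpret prob_space \<mu> by fact
    show "(\<integral>x. h (Suc n) x \<partial>\<mu>) \<le> (\<integral>x. h n x \<partial>\<mu>)" for n
      by (intro integral_mono bcont_integrable[OF \<mu>] h) (simp add: D dec)
    obtain c where c: "\<And>x. x \<in> topspace X \<Longrightarrow> \<bar>h 0 x\<bar> \<le> c" using bcontE[OF h] by metis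
    have bd: "\<bar>h n x\<bar> \<le> c" if x: "x \<in> topspace X" for n x
    proof -
      have "h n x \<le> h 0 x"
        using lift_Suc_antimono_le[of "\<lambda>n. h n x" 0 n] dec x by blast
      moreover have "0 \<le> h n x"
        by (rule decseq_ge[OF decseq_SucI lim[OF x]]) (simp add: dec x)
      ultimately show ?thesis using c[OF x] by linarith
    qed
    have "(\<lambda>n. \<integral>x. h n x \<partial>\<mu>) \<longlonglongrightarrow> (\<integral>x. 0 \<partial>\<mu>)"
    proof (rule integral_dominated_convergence[where w="\<lambda>_. c"])
      show "h n \<in> borel_measurable \<mu>" for n using bcont_integrable[OF \<mu> h] by auto
    qed (auto simp: D lim bd)
    then show "(\<lambda>n. \<integral>x. h n x \<partial>\<mu>) \<longlonglongrightarrow> 0" by simp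
  qed
  then show ?thesis using closure_of_subset[OF A'] by blast
qed

section \<open>Representation of smooth functionals by measures\<close>

text \<open>Smoothness (continuity along decreasing sequences) is what separates the integrals of countably
  additive measures from other positive functionals. The cozero property lets bounded continuous
  functions see all open sets, so that the measure can be built from the outside on open sets.\<close>
locale daniell_functional =
  fixes X :: "'b topology" and L :: "('b \<Rightarrow> real) \<Rightarrow> real"
  assumes cozero: "cozero_space X"
    and add: "\<And>h g. h \<in> bcont X \<Longrightarrow> g \<in> bcont X \<Longrightarrow> L (\<lambda>x. h x + g x) = L h + L g"
    and cmult: "\<And>c h. h \<in> bcont X \<Longrightarrow> L (\<lambda>x. c * h x) = c * L h"
    and pos: "\<And>h. h \<in> bcont X \<Longrightarrow> (\<And>x. x \<in> topspace X \<Longrightarrow> 0 \<le> h x) \<Longrightarrow> 0 \<le> L h"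
    and one: "L (\<lambda>_. 1) = 1"
    and smooth: "\<And>h. (\<And>n. h n \<in> bcont X) \<Longrightarrow>
        (\<And>n x. x \<in> topspace X \<Longrightarrow> h (Suc n) x \<le> h n x) \<Longrightarrow>
        (\<And>x. x \<in> topspace X \<Longrightarrow> (\<lambda>n. h n x) \<longlonglongrightarrow> (0::real)) \<Longrightarrow> (\<lambda>n. L (h n)) \<longlonglongrightarrow> 0"
begin

lemma const: "L (\<lambda>_. c) = c"
  using cmult[OF bcont_const[of 1], of c] one by simp

lemma diff:
  assumes "h \<in> bcont X" "g \<in> bcont X" shows "L (\<lambda>x. h x - g x) = L h - L g"
  using add[OF bcont_diff[OF assms] assms(2)] by simp

lemma mono:
  assumes "h \<in> bcont X" "g \<in> bcont X" "\<And>x. x \<in> topspace X \<Longrightarrow> h x \<le> g x"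
  shows "L h \<le> L g"
  using pos[OF bcont_diff[OF assms(2,1)]] diff[OF assms(2,1)] assms(3) by simp

lemma sum:
  assumes "\<And>i. i \<in> I \<Longrightarrow> h i \<in> bcont X" shows "L (\<lambda>x. \<Sum>i\<in>I. h i x) = (\<Sum>i\<in>I. L (h i))"
  using assms
proof (induction I rule: infinite_finite_induct)
  case (insert i I)
  then show ?case by (simp add: add bcont_sum)
qed (simp_all add: const)

definition below :: "'b set \<Rightarrow> ('b \<Rightarrow> real) set" where
  "below G = {h \<in> bcont X. \<forall>x\<in>topspace X. 0 \<le> h x \<and> h x \<le> indicator G x}"

text \<open>The value that a representing measure has to take on an open set \<open>G\<close>, whose indicator is an
  increasing limit of functions in \<open>below G\<close>.\<close>
definition inner :: "'b set \<Rightarrow> ennreal" where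
  "inner G = (SUP h\<in>below G. ennreal (L h))"

definition outer :: "'b set \<Rightarrow> ennreal" where
  "outer A = (INF G\<in>{G. openin X G \<and> A \<subseteq> G}. inner G)"

lemma belowD:
  assumes "h \<in> below G"
  shows "h \<in> bcont X" "\<And>x. x \<in> topspace X \<Longrightarrow> 0 \<le> h x" "\<And>x. x \<in> topspace X \<Longrightarrow> h x \<le> indicator G x" "0 \<le> L h"
  using assms pos unfolding below_def by auto

lemma belowI:
  assumes "h \<in> bcont X" "\<And>x. x \<in> topspace X \<Longrightarrow> 0 \<le> h x" "\<And>x. x \<in> topspace X \<Longrightarrow> h x \<le> indicator G x"
  shows "h \<in> below G"
  using assms unfolding below_def by auto

lemma inner_upper: "h \<in> below G \<Longrightarrow> ennreal (L h) \<le> inner G"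
  unfolding inner_def by (rule SUP_upper)

lemma inner_le_one: "inner G \<le> 1"
  unfolding inner_def
proof (rule SUP_least)
  fix h assume h: "h \<in> below G"
  have "L h \<le> L (\<lambda>_. 1)"
    by (rule mono[OF belowD(1)[OF h] bcont_const])
      (rule order_trans[OF belowD(3)[OF h] indicator_le_1])
  then show "ennreal (L h) \<le> 1" by (simp add: one)
qed

lemma inner_mono: "G \<subseteq> H \<Longrightarrow> inner G \<le> inner H"
  unfolding inner_def below_def
  by (rule SUP_subset_mono) (auto intro: order_trans simp: indicator_def split: if_splits)

lemma outer_open: "openin X G \<Longrightarrow> outer G = inner G"
  unfolding outer_def by (rule antisym) (auto intro: INF_lower2 INF_greatest inner_mono)

lemma outer_mono: "A \<subseteq> B \<Longrightarrow> outer A \<le> outer B"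
  unfolding outer_def by (rule INF_superset_mono) auto

text \<open>If \<open>0 \<le> h \<le> 1\<close> on \<open>\<Union>n. G n\<close> and \<open>h = 0\<close> elsewhere, approximate each indicator of \<open>G n\<close> from below
  by \<open>min 1 (N e\<^sub>n)\<close>. The part of \<open>h\<close> that exceeds the sum of the first \<open>N\<close> of these functions decreases to
  \<open>0\<close> as \<open>N\<close> grows, so its integral vanishes by smoothness.\<close>
lemma inner_Union:
  fixes G :: "nat \<Rightarrow> 'b set"
  assumes G: "\<And>n. openin X (G n)"
  shows "inner (\<Union>n. G n) \<le> (\<Sum>n. inner (G n))"
  unfolding inner_def[of "\<Union>n. G n"]
proof (rule SUP_least)
  fix h assume h: "h \<in> below (\<Union>n. G n)"
  have "\<forall>n. \<exists>e\<in>bcont X. (\<forall>x\<in>topspace X. 0 \<le> e x \<and> e x \<le> 1) \<and> G n = {x\<in>topspace X. 0 < e x}"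
    using cozero G unfolding cozero_space_def cozero_in_def by blast
  then obtain e where e: "\<And>n. e n \<in> bcont X" "\<And>n x. x \<in> topspace X \<Longrightarrow> 0 \<le> e n x"
      "\<And>n. G n = {x\<in>topspace X. 0 < e n x}" by metis
  define g where "g n N x = min 1 (real N * e n x)" for n N x
  have g: "g n N \<in> below (G n)" for n N
  proof (rule belowI)
    show "g n N \<in> bcont X" unfolding g_def by (intro bcont_min bcont_const bcont_cmult e)
  next
    fix x assume x: "x \<in> topspace X"
    then show "0 \<le> g n N x" using e(2) by (simp add: g_def)
    show "g n N x \<le> indicator (G n) x"
      using e(2)[OF x, of n] x by (cases "0 < e n x") (auto simp: g_def e(3))
  qed
  define d where "d N x = max 0 (h x - (\<Sum>n<N. g n N x))" for N x
  have dC: "d N \<in> bcont X" for N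
    unfolding d_def using g h
    by (intro bcont_max bcont_const bcont_diff bcont_sum) (auto dest: belowD)
  have lim: "(\<lambda>N. L (d N)) \<longlonglongrightarrow> 0"
  proof (rule smooth[OF dC])
    fix N x assume x: "x \<in> topspace X"
    have "(\<Sum>n<N. g n N x) \<le> (\<Sum>n<N. g n (Suc N) x)"
      unfolding g_def using e(2)[OF x] by (intro sum_mono min.mono mult_right_mono) auto
    also have "\<dots> \<le> (\<Sum>n<Suc N. g n (Suc N) x)"
      using belowD(2)[OF g x] by simp
    finally show "d (Suc N) x \<le> d N x" unfolding d_def by simp
  next
    fix x assume x: "x \<in> topspace X"
    show "(\<lambda>N. d N x) \<longlonglongrightarrow> 0"
    proof (cases "x \<in> (\<Union>n. G n)")
      case False
      then have "h x \<le> 0" using belowD(3)[OF h x] by simp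
      then have "d N x = 0" for N
        using sum_nonneg[of "{..<N}" "\<lambda>n. g n N x"] belowD(2)[OF g x] unfolding d_def by simp
      then show ?thesis by simp
    next
      case True
      then obtain n where n: "0 < e n x" using e(3) by auto
      obtain M where M: "1 < real M * e n x" using reals_Archimedean3[OF n] by blast
      have "d N x = 0" if N: "N \<ge> max M (Suc n)" for N
      proof -
        have "real M * e n x \<le> real N * e n x" using N n by (intro mult_right_mono) auto
        then have "g n N x = 1" using M by (simp add: g_def)
        moreover have "g n N x \<le> (\<Sum>n<N. g n N x)"
          using N by (intro member_le_sum) (auto intro: belowD(2)[OF g x])
        moreover have "h x \<le> 1" using belowD(3)[OF h x] True by simp
        ultimately show ?thesis unfolding d_def by simp
      qed
      then have "eventually (\<lambda>N. d N x = 0) sequentially" by (rule eventually_sequentiallyI)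
      then show ?thesis by (rule tendsto_eventually)
    qed
  qed
  have le: "ennreal (L h) \<le> ennreal (L (d N)) + (\<Sum>n. inner (G n))" for N
  proof -
    have gC: "(\<lambda>x. \<Sum>n<N. g n N x) \<in> bcont X" using g by (intro bcont_sum) (auto dest: belowD)
    have "L h \<le> L (\<lambda>x. d N x + (\<Sum>n<N. g n N x))"
      by (rule mono[OF belowD(1)[OF h] bcont_add[OF dC gC]]) (simp add: d_def)
    also have "\<dots> = L (d N) + (\<Sum>n<N. L (g n N))"
      using g by (subst add[OF dC gC], subst sum) (auto dest: belowD)
    finally have "ennreal (L h) \<le> ennreal (L (d N) + (\<Sum>n<N. L (g n N)))" by (rule ennreal_leI)
    also have "\<dots> = ennreal (L (d N)) + (\<Sum>n<N. ennreal (L (g n N)))"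
      using pos[OF dC] belowD(4)[OF g] by (subst ennreal_plus) (auto simp: d_def sum_nonneg sum_ennreal)
    also have "\<dots> \<le> ennreal (L (d N)) + (\<Sum>n<N. inner (G n))"
      by (intro add_left_mono sum_mono inner_upper g)
    also have "\<dots> \<le> ennreal (L (d N)) + (\<Sum>n. inner (G n))"
      by (intro add_left_mono sum_le_suminf) auto
    finally show ?thesis .
  qed
  have "(\<lambda>N. ennreal (L (d N)) + (\<Sum>n. inner (G n))) \<longlonglongrightarrow> ennreal 0 + (\<Sum>n. inner (G n))"
    by (intro tendsto_add tendsto_ennrealI lim tendsto_const)
  then show "ennreal (L h) \<le> (\<Sum>n. inner (G n))"
    using le by (intro LIMSEQ_le_const[where X="\<lambda>N. ennreal (L (d N)) + (\<Sum>n. inner (G n))"]) auto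
qed

text \<open>An open superset is needed up to a real \<open>e\<close>, and in \<^typ>\<open>ennreal\<close> the strict inequality
  \<open>outer A < outer A + e\<close> requires \<open>outer A\<close> to be finite.\<close>
lemma outer_approx:
  assumes "A \<subseteq> topspace X" "0 < e"
  obtains G where "openin X G" "A \<subseteq> G" "inner G \<le> outer A + ennreal e"
proof -
  have "outer A \<le> 1"
    using assms(1) inner_le_one[of "topspace X"] unfolding outer_def
    by (intro INF_lower2[of "topspace X"]) auto
  then obtain r where "outer A = ennreal r" "0 \<le> r" by (cases "outer A") (auto simp: top_unique)
  then have "outer A < outer A + ennreal e"
    using assms(2) by (simp add: ennreal_plus[symmetric] ennreal_less_iff del: ennreal_plus)
  then show ?thesis using that unfolding outer_def INF_less_iff by (auto intro: less_imp_le)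
qed

lemma outer_measure_space_outer: "outer_measure_space (Pow (topspace X)) outer"
  unfolding outer_measure_space_def
proof (intro conjI)
  have "L h = 0" if "h \<in> below {}" for h
    using mono[OF belowD(1)[OF that] bcont_const[of 0]] belowD[OF that] const[of 0] by force
  then have "inner {} \<le> 0"
    unfolding inner_def by (intro SUP_least) simp
  then show "positive (Pow (topspace X)) outer"
    by (simp add: positive_def outer_open)
  show "increasing (Pow (topspace X)) outer"
    by (simp add: increasing_def outer_mono)
  show "countably_subadditive (Pow (topspace X)) outer"
    unfolding countably_subadditive_def
  proof (intro allI impI)
    fix A :: "nat \<Rightarrow> 'b set"
    assume A: "range A \<subseteq> Pow (topspace X)"
    show "outer (\<Union>i. A i) \<le> (\<Sum>i. outer (A i))"
    proof (rule ennreal_le_epsilon)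
      fix e :: real assume e: "0 < e"
      have "\<exists>G. openin X G \<and> A n \<subseteq> G \<and> inner G \<le> outer (A n) + ennreal (e * (1/2) ^ Suc n)" for n
      proof -
        have "A n \<subseteq> topspace X" "0 < e * (1/2) ^ Suc n" using A e by auto
        then show ?thesis using outer_approx by metis
      qed
      then obtain G where G: "\<And>n. openin X (G n)" "\<And>n. A n \<subseteq> G n"
          "\<And>n. inner (G n) \<le> outer (A n) + ennreal (e * (1/2) ^ Suc n)" by metis
      have "outer (\<Union>i. A i) \<le> inner (\<Union>i. G i)"
        unfolding outer_def using G by (intro INF_lower) auto
      also have "\<dots> \<le> (\<Sum>i. inner (G i))" by (rule inner_Union[OF G(1)])
      also have "\<dots> \<le> (\<Sum>i. outer (A i) + ennreal (e * (1/2) ^ Suc i))"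
        by (intro suminf_le G) auto
      also have "\<dots> = (\<Sum>i. outer (A i)) + (\<Sum>i. ennreal (e * (1/2) ^ Suc i))"
        by (rule suminf_add[symmetric]) auto
      also have "(\<Sum>i. ennreal (e * (1/2) ^ Suc i)) = ennreal (e * 1)"
        using e by (intro suminf_ennreal_eq sums_mult power_half_series) auto
      finally show "outer (\<Union>i. A i) \<le> (\<Sum>i. outer (A i)) + ennreal e" by simp
    qed
  qed
qed

text \<open>A competitor \<open>h\<close> for \<open>G \<inter> U\<close>, lowered by \<open>d\<close>, lives on \<open>{h > d}\<close>, and \<open>G - U\<close> lies in the open set
  \<open>G \<inter> {h < d}\<close>, on which any competitor may be added without exceeding the indicator of \<open>G\<close>.
  Lowering costs at most \<open>d\<close>.\<close>
lemma inner_split: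
  assumes G: "openin X G" and U: "openin X U"
  shows "outer (G \<inter> U) + outer (G - U) \<le> inner G"
proof -
  have GX: "G \<subseteq> topspace X" using G by (rule openin_subset)
  have main: "ennreal (L h) + outer (G - U) \<le> inner G" if h: "h \<in> below (G \<inter> U)" for h
  proof (rule ennreal_le_epsilon)
    fix d :: real assume d: "0 < d"
    let ?H = "G \<inter> {x \<in> topspace X. h x \<in> {..<d}}"
    let ?k = "\<lambda>x. max 0 (h x - d)"
    have H: "openin X ?H"
      by (intro openin_Int G openin_bcont_preimage belowD(1)[OF h]) auto
    have kC: "?k \<in> bcont X"
      by (intro bcont_max bcont_diff bcont_const belowD(1)[OF h])
    have hk: "L h \<le> L ?k + d"
    proof -
      have "L h \<le> L (\<lambda>x. ?k x + d)"
        by (rule mono[OF belowD(1)[OF h] bcont_add[OF kC bcont_const]]) auto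
      then show ?thesis using add[OF kC bcont_const[of d]] by (simp add: const)
    qed
    have "G - U \<subseteq> ?H"
    proof
      fix x assume x: "x \<in> G - U"
      with GX have "x \<in> topspace X" by auto
      with belowD(3)[OF h this] x d show "x \<in> ?H" by simp
    qed
    from outer_mono[OF this] have "outer (G - U) \<le> inner ?H"
      unfolding outer_open[OF H] .
    then have "ennreal (L h) + outer (G - U) \<le> ennreal (L h) + (SUP h'\<in>below ?H. ennreal (L h'))"
      unfolding inner_def by (rule add_left_mono)
    also have "\<dots> = (SUP h'\<in>below ?H. ennreal (L h) + ennreal (L h'))"
    proof (rule ennreal_SUP_add_right)
      show "below ?H \<noteq> {}" using belowI[OF bcont_const[of 0]] by fastforce
    qed
    also have "\<dots> \<le> inner G + ennreal d"
    proof (rule SUP_least)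
      fix h' assume h': "h' \<in> below ?H"
      have "(\<lambda>x. ?k x + h' x) \<in> below G"
      proof (rule belowI)
        show "(\<lambda>x. ?k x + h' x) \<in> bcont X" by (intro bcont_add kC belowD(1)[OF h'])
        fix x assume x: "x \<in> topspace X"
        show "0 \<le> ?k x + h' x" using belowD(2)[OF h' x] by simp
        show "?k x + h' x \<le> indicator G x"
          using belowD(2,3)[OF h' x] belowD(2,3)[OF h x] order_trans[OF belowD(3)[OF h x] indicator_le_1] d x
          by (cases "h x < d") (auto simp: indicator_def split: if_splits)
      qed
      from inner_upper[OF this] have "ennreal (L ?k + L h') \<le> inner G"
        using add[OF kC belowD(1)[OF h']] by simp
      moreover have "ennreal (L h) + ennreal (L h') \<le> ennreal (L ?k + L h') + ennreal d"
        using hk belowD(4)[OF h] belowD(4)[OF h'] d pos[OF kC]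
        by (simp add: ennreal_plus[symmetric] ennreal_leI del: ennreal_plus)
      ultimately show "ennreal (L h) + ennreal (L h') \<le> inner G + ennreal d"
        by (meson add_right_mono order_trans)
    qed
    finally show "ennreal (L h) + outer (G - U) \<le> inner G + ennreal d" .
  qed
  have "outer (G \<inter> U) + outer (G - U) = (SUP h\<in>below (G \<inter> U). ennreal (L h) + outer (G - U))"
    unfolding outer_open[OF openin_Int[OF G U]] inner_def
    by (rule ennreal_SUP_add_left[symmetric]) (use belowI[OF bcont_const[of 0]] in fastforce)
  also have "\<dots> \<le> inner G" by (rule SUP_least) (rule main)
  finally show ?thesis .
qed

text \<open>Approximating an arbitrary set by open supersets reduces Caratheodory's condition to
  \<open>inner_split\<close>.\<close>
lemma open_caratheodory:
  assumes U: "openin X U"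
  shows "U \<in> lambda_system (topspace X) (Pow (topspace X)) outer"
proof -
  have sub: "outer (A \<union> B) \<le> outer A + outer B" if "A \<subseteq> topspace X" "B \<subseteq> topspace X" for A B
  proof -
    interpret algebra "topspace X" "Pow (topspace X)" by (rule algebra_Pow)
    have "subadditive (Pow (topspace X)) outer"
      using outer_measure_space_outer unfolding outer_measure_space_def
      by (intro countably_subadditive_subadditive) auto
    moreover have "subadditive (Pow (topspace X)) outer \<Longrightarrow> ?thesis"
    proof -
      assume s: "subadditive (Pow (topspace X)) outer"
      have "outer (A \<union> (B - A)) \<le> outer A + outer (B - A)"
        using s that unfolding subadditive_def by (metis Diff_disjoint Diff_subset PowI order_trans)
      also have "\<dots> \<le> outer A + outer B" by (intro add_left_mono outer_mono) auto
      finally show ?thesis by simp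
    qed
    ultimately show ?thesis by blast
  qed
  have "outer (U \<inter> A) + outer ((topspace X - U) \<inter> A) = outer A" if A: "A \<subseteq> topspace X" for A
  proof (rule antisym)
    have "A = (U \<inter> A) \<union> ((topspace X - U) \<inter> A)" using A by auto
    then show "outer A \<le> outer (U \<inter> A) + outer ((topspace X - U) \<inter> A)"
      using sub[of "U \<inter> A" "(topspace X - U) \<inter> A"] A by auto
    show "outer (U \<inter> A) + outer ((topspace X - U) \<inter> A) \<le> outer A"
    proof (rule ennreal_le_epsilon)
      fix e :: real assume "0 < e"
      then obtain G where G: "openin X G" "A \<subseteq> G" "inner G \<le> outer A + ennreal e"
        using outer_approx A by blast
      have "outer (U \<inter> A) + outer ((topspace X - U) \<inter> A) \<le> outer (G \<inter> U) + outer (G - U)"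
        using G(2) by (intro add_mono outer_mono) auto
      also have "\<dots> \<le> inner G" by (rule inner_split[OF G(1) U])
      finally show "outer (U \<inter> A) + outer ((topspace X - U) \<inter> A) \<le> outer A + ennreal e"
        using G(3) by (rule order_trans)
    qed
  qed
  then show ?thesis using openin_subset[OF U] by (simp add: lambda_system_def)
qed

definition rep_measure :: "'b measure" where
  "rep_measure = measure_of (topspace X) {U. openin X U} outer"

lemma sets_rep_measure: "sets rep_measure = sets (borel_of X)"
  unfolding rep_measure_def sets_borel_of by (rule sets_measure_of) (auto dest: openin_subset)

lemma emeasure_rep_measure:
  assumes "A \<in> sets (borel_of X)" shows "emeasure rep_measure A = outer A"
proof -
  interpret S: sigma_algebra "topspace X" "Pow (topspace X)" by (rule sigma_algebra_Pow)
  let ?\<Lambda> = "lambda_system (topspace X) (Pow (topspace X)) outer"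
  have ms: "measure_space (topspace X) ?\<Lambda> outer"
    by (rule S.caratheodory_lemma[OF outer_measure_space_outer])
  then interpret \<Lambda>: sigma_algebra "topspace X" ?\<Lambda> by (simp add: measure_space_def)
  have sub: "sigma_sets (topspace X) {U. openin X U} \<subseteq> ?\<Lambda>"
    by (rule \<Lambda>.sigma_sets_subset) (use open_caratheodory in auto)
  have A: "A \<in> sigma_sets (topspace X) {U. openin X U}" using assms by (simp add: sets_borel_of)
  show ?thesis
  proof (rule emeasure_measure_of[OF rep_measure_def])
    show "{U. openin X U} \<subseteq> Pow (topspace X)" by (auto dest: openin_subset)
    show "A \<in> sets rep_measure" using assms by (simp add: sets_rep_measure)
    show "positive (sets rep_measure) outer"
      using ms by (simp add: measure_space_def positive_def)
    show "countably_additive (sets rep_measure) outer"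
      using ms sub unfolding measure_space_def countably_additive_def sets_rep_measure sets_borel_of
      by (meson order_trans subsetD)
  qed
qed

lemma rep_measure_prob: "rep_measure \<in> prob_measures X"
proof -
  have sp: "space rep_measure = topspace X" using sets_eq_imp_space_eq[OF sets_rep_measure] by simp
  have "(\<lambda>_. 1) \<in> below (topspace X)" by (rule belowI) (auto simp: bcont_const)
  from inner_upper[OF this] have "1 \<le> inner (topspace X)" by (simp add: one)
  then have "inner (topspace X) = 1" using inner_le_one by (rule antisym[rotated])
  then have "emeasure rep_measure (space rep_measure) = 1"
    by (simp add: sp emeasure_rep_measure openin_sets_borel_of outer_open)
  then show ?thesis by (auto simp: prob_measures_def sets_rep_measure intro: prob_spaceI)
qed

text \<open>Cut \<open>h\<close> into the \<open>n\<close> layers \<open>s i = min (max (h - i/n) 0) (1/n)\<close>. Since \<open>n s i\<close> is a competitor for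
  \<open>G i = {h > i/n}\<close>, \<open>L h\<close> is at most \<open>\<Sum>i<n. \<mu> (G i) / n\<close>, which is the integral of a
  step function that exceeds \<open>h\<close> by at most \<open>1/n\<close>.\<close>
lemma L_le_integral_unit:
  assumes h: "h \<in> bcont X" and bd: "\<And>x. x \<in> topspace X \<Longrightarrow> 0 \<le> h x" "\<And>x. x \<in> topspace X \<Longrightarrow> h x \<le> 1"
  shows "L h \<le> (\<integral>x. h x \<partial>rep_measure)"
proof (rule field_le_epsilon)
  fix e :: real assume "0 < e"
  then obtain n :: nat where n: "0 < n" "1 / real n < e"
    using nat_approx_posE by (metis zero_less_Suc)
  define s where "s i x = min (max (h x - real i / n) 0) (1 / n)" for i x
  define G where "G i = {x \<in> topspace X. h x \<in> {real i / n<..}}" for i :: nat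
  interpret R: prob_space rep_measure using prob_measures_D(3)[OF rep_measure_prob] .
  have spR: "space rep_measure = topspace X" using prob_measures_D(2)[OF rep_measure_prob] .
  have sC: "s i \<in> bcont X" for i
    unfolding s_def by (intro bcont_min bcont_max bcont_diff bcont_const h)
  have Go: "openin X (G i)" for i
    unfolding G_def by (intro openin_bcont_preimage h) auto
  have Gs: "G i \<in> sets rep_measure" for i by (simp add: sets_rep_measure Go openin_sets_borel_of)
  \<comment> \<open>The layers add up to \<open>h\<close>; the statement for every \<open>k\<close> is what the induction needs.\<close>
  have part: "(\<Sum>i<k. min (max (y - real i / n) 0) (1 / n)) = min (max y 0) (real k / n)" for k and y :: real
  proof (induction k)
    case 0 then show ?case by auto
  next
    case (Suc k)
    have step: "min (max y 0) a + min (max (y - a) 0) b = min (max y 0) (a + b)"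
      if "0 \<le> a" "0 \<le> b" for a b :: real
      using that by (auto simp: min_def max_def)
    have "real (Suc k) / n = real k / n + 1 / n" by (simp add: add_divide_distrib)
    with Suc step[of "real k / n" "1 / n"] show ?case by simp
  qed
  have hs: "h x = (\<Sum>i<n. s i x)" if "x \<in> topspace X" for x
    using bd[OF that] n unfolding s_def part by simp
  have sL: "L (s i) \<le> measure rep_measure (G i) / n" for i
  proof -
    have "(\<lambda>x. real n * s i x) \<in> below (G i)"
    proof (rule belowI)
      show "(\<lambda>x. real n * s i x) \<in> bcont X" by (rule bcont_cmult[OF sC])
      fix x assume x: "x \<in> topspace X"
      show "0 \<le> real n * s i x" by (simp add: s_def)
      show "real n * s i x \<le> indicator (G i) x"
      proof (cases "x \<in> G i")
        case True
        have "real n * s i x \<le> real n * (1 / n)" by (intro mult_left_mono) (simp_all add: s_def)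
        then show ?thesis using True n by simp
      next
        case False
        then have "h x - real i / n \<le> 0" using x by (simp add: G_def)
        then have "s i x = 0" by (simp add: s_def max_absorb2)
        then show ?thesis by simp
      qed
    qed
    from inner_upper[OF this] have "ennreal (real n * L (s i)) \<le> emeasure rep_measure (G i)"
      by (simp add: emeasure_rep_measure Go openin_sets_borel_of outer_open cmult[OF sC])
    then have "real n * L (s i) \<le> measure rep_measure (G i)"
      by (simp add: R.emeasure_eq_measure)
    then show ?thesis using n by (simp add: field_simps)
  qed
  have int1: "integrable rep_measure (\<lambda>x. indicator (G i) x / real n)" for i
    by (intro integrable_divide R.integrable_const_bound[where B=1] borel_measurable_indicator Gs) auto
  have int: "integrable rep_measure (\<lambda>x. \<Sum>i<n. indicator (G i) x / real n)"
    by (intro Bochner_Integration.integrable_sum int1)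
  have ptw: "(\<Sum>i<n. indicator (G i) x / real n) \<le> h x + 1 / n" if x: "x \<in> topspace X" for x
  proof -
    have gen: "(\<Sum>i<k. indicator (G i) x / real n) \<le> h x + 1 / n" for k
    proof (induction k)
      case 0 then show ?case using bd(1)[OF x] by simp
    next
      case (Suc k)
      show ?case
      proof (cases "x \<in> G k")
        case True
        have "(\<Sum>i<Suc k. indicator (G i) x / real n) \<le> (\<Sum>i<Suc k. 1 / real n)"
          by (intro sum_mono divide_right_mono) (auto simp: indicator_def)
        also have "\<dots> = real k / n + 1 / n" by (simp add: add_divide_distrib)
        also have "\<dots> \<le> h x + 1 / n" using True by (simp add: G_def)
        finally show ?thesis .
      next
        case False
        then show ?thesis using Suc by simp
      qed
    qed
    then show ?thesis .
  qed
  have "L h \<le> L (\<lambda>x. \<Sum>i<n. s i x)"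
    by (rule mono[OF h bcont_sum]) (simp_all add: sC hs)
  also have "\<dots> = (\<Sum>i<n. L (s i))" by (rule sum) (rule sC)
  also have "\<dots> \<le> (\<Sum>i<n. measure rep_measure (G i) / n)" by (intro sum_mono sL)
  also have "\<dots> = (\<integral>x. (\<Sum>i<n. indicator (G i) x / real n) \<partial>rep_measure)"
    using sets.sets_into_space[OF Gs]
    by (subst Bochner_Integration.integral_sum[OF int1]) (simp add: Int_absorb2)
  also have "\<dots> \<le> (\<integral>x. h x + 1 / n \<partial>rep_measure)"
    by (rule integral_mono[OF int bcont_integrable[OF rep_measure_prob bcont_add[OF h bcont_const]]])
      (simp add: spR ptw)
  also have "\<dots> = (\<integral>x. h x \<partial>rep_measure) + 1 / n"
    using bcont_integrable[OF rep_measure_prob h] R.prob_space by simp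
  finally show "L h \<le> (\<integral>x. h x \<partial>rep_measure) + e" using n by simp
qed

text \<open>One inequality suffices, as it also applies to \<open>- h\<close>; an affine change brings a bounded function
  into the range of \<open>L_le_integral_unit\<close>.\<close>
lemma L_eq_integral:
  assumes h: "h \<in> bcont X" shows "L h = (\<integral>x. h x \<partial>rep_measure)"
proof -
  interpret R: prob_space rep_measure using prob_measures_D(3)[OF rep_measure_prob] .
  have le: "L h \<le> (\<integral>x. h x \<partial>rep_measure)" if h: "h \<in> bcont X" for h
  proof -
    obtain c where c: "0 < c" "\<And>x. x \<in> topspace X \<Longrightarrow> \<bar>h x\<bar> \<le> c" using bcontE[OF h] by blast
    let ?g = "\<lambda>x. 1 / (2 * c) * h x + 1 / 2"
    have gC: "?g \<in> bcont X" by (intro bcont_add bcont_cmult bcont_const h)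
    have "L ?g \<le> (\<integral>x. ?g x \<partial>rep_measure)"
    proof (rule L_le_integral_unit[OF gC])
      fix x assume "x \<in> topspace X"
      from c(2)[OF this] c(1) show "0 \<le> ?g x" "?g x \<le> 1"
        by (auto simp: field_simps abs_le_iff)
    qed
    moreover have "L ?g = 1 / (2 * c) * L h + 1 / 2"
      by (subst add[OF bcont_cmult[OF h] bcont_const], subst cmult[OF h], subst const) simp
    moreover have "(\<integral>x. ?g x \<partial>rep_measure) = 1 / (2 * c) * (\<integral>x. h x \<partial>rep_measure) + 1 / 2"
      using bcont_integrable[OF rep_measure_prob h] R.prob_space by simp
    ultimately show ?thesis using c(1) by (simp add: field_simps)
  qed
  have "- L h \<le> - (\<integral>x. h x \<partial>rep_measure)"
    using le[OF bcont_cmult[OF h, of "-1"]] cmult[OF h, of "-1"] by simp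
  then show ?thesis using le[OF h] by simp
qed

theorem representation: "\<exists>\<mu>\<in>prob_measures X. \<forall>h\<in>bcont X. L h = (\<integral>x. h x \<partial>\<mu>)"
  using rep_measure_prob L_eq_integral by blast

end

section \<open>Relative compactness of tight families\<close>

text \<open>The value \<open>0\<close> outside \<^term>\<open>bcont X\<close> keeps the images of all probability measures inside one
  product of compact intervals.\<close>
definition integrals :: "'b topology \<Rightarrow> 'b measure \<Rightarrow> ('b \<Rightarrow> real) \<Rightarrow> real" where
  "integrals X \<mu> h = (if h \<in> bcont X then \<integral>x. h x \<partial>\<mu> else 0)"

lemma continuous_map_integrals: "continuous_map (weak_topology X) euclidean (integrals X)"
proof -
  have "continuous_map (weak_topology X) (product_topology (\<lambda>_. euclideanreal) UNIV) (integrals X)"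
  proof (rule continuous_map_coordinatewise_then_product)
    show "continuous_map (weak_topology X) euclideanreal (\<lambda>\<mu>. integrals X \<mu> h)" for h
      by (cases "h \<in> bcont X") (simp_all add: integrals_def continuous_integral_weak_topology)
  qed simp
  then show ?thesis by (simp add: euclidean_product_topology)
qed

text \<open>The weak topology is the initial topology of the map \<open>integrals X\<close>.\<close>
lemma openin_weak_topologyD:
  fixes X :: "'b topology"
  assumes "openin (weak_topology X) U"
  shows "\<exists>V. open V \<and> U = {\<mu> \<in> prob_measures X. integrals X \<mu> \<in> V}"
proof -
  have "generate_topology_on {{\<mu> \<in> prob_measures X. (\<integral>x. h x \<partial>\<mu>) \<in> U} | h U.
        continuous_map X euclideanreal h \<and> bounded (h ` topspace X) \<and> open U} U"
    using assms unfolding weak_topology_def by (rule openin_topology_generated_by)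
  then show ?thesis
  proof induction
    case Empty
    show ?case by (rule exI[of _ "{}"]) simp
  next
    case (Int a b)
    then obtain V W where "open V" "a = {\<mu> \<in> prob_measures X. integrals X \<mu> \<in> V}"
      "open W" "b = {\<mu> \<in> prob_measures X. integrals X \<mu> \<in> W}" by blast
    then show ?case by (intro exI[of _ "V \<inter> W"] conjI open_Int) auto
  next
    case (UN K)
    then have "\<forall>k\<in>K. \<exists>V. open V \<and> k = {\<mu> \<in> prob_measures X. integrals X \<mu> \<in> V}" by simp
    from bchoice[OF this] obtain V where V: "\<And>k. k \<in> K \<Longrightarrow> open (V k)"
      "\<And>k. k \<in> K \<Longrightarrow> k = {\<mu> \<in> prob_measures X. integrals X \<mu> \<in> V k}" by blast
    have "\<Union>K = {\<mu> \<in> prob_measures X. integrals X \<mu> \<in> (\<Union>k\<in>K. V k)}"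
      using V(2) by (intro set_eqI) blast
    then show ?case using V(1) by (intro exI[of _ "\<Union>k\<in>K. V k"] conjI open_UN) auto
  next
    case (Basis s)
    then obtain h W where hW: "s = {\<mu> \<in> prob_measures X. (\<integral>x. h x \<partial>\<mu>) \<in> W}" "h \<in> bcont X" "open W"
      by (auto simp: bcont_def)
    have "open ((\<lambda>l :: ('b \<Rightarrow> real) \<Rightarrow> real. l h) -` W)"
      using hW(3) by (rule open_vimage) (rule continuous_on_product_coordinates)
    moreover have "s = {\<mu> \<in> prob_measures X. integrals X \<mu> \<in> (\<lambda>l. l h) -` W}"
      using hW by (simp add: integrals_def)
    ultimately show ?case by blast
  qed
qed

text \<open>The closure of the image of \<open>A\<close> is compact by Tychonoff's theorem. If all its points come from
  probability measures, these measures lie in the closure of \<open>A\<close>, so an open cover of the closure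
  of \<open>A\<close> is the preimage of an open cover of a compact set.\<close>
lemma relatively_compact_weakI:
  assumes A: "A \<subseteq> prob_measures X"
    and cl: "closure (integrals X ` A) \<subseteq> integrals X ` prob_measures X"
  shows "relatively_compactin (weak_topology X) A"
proof -
  let ?E = "integrals X"
  let ?C = "weak_topology X closure_of A"
  define F where "F = closure (?E ` A)"
  obtain c where c: "\<And>h x. h \<in> bcont X \<Longrightarrow> x \<in> topspace X \<Longrightarrow> \<bar>h x\<bar> \<le> c h"
    "\<And>h. h \<in> bcont X \<Longrightarrow> 0 < c h"
    using bcontE by metis
  define S where "S = PiE UNIV (\<lambda>h. {- \<bar>c h\<bar>..\<bar>c h\<bar>})"
  have "compactin (product_topology (\<lambda>_. euclideanreal) UNIV) S"
    unfolding S_def compactin_PiE by simp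
  then have S: "compact S" by (simp add: euclidean_product_topology)
  have "S = {l. \<forall>h. - \<bar>c h\<bar> \<le> l h \<and> l h \<le> \<bar>c h\<bar>}"
    unfolding S_def PiE_UNIV_domain by auto
  then have cS: "closed S"
    by (auto intro!: closed_Collect_all closed_Collect_conj closed_Collect_le continuous_on_const
        continuous_on_product_coordinates)
  have "?E \<mu> \<in> S" if "\<mu> \<in> A" for \<mu>
  proof -
    have \<mu>: "\<mu> \<in> prob_measures X" using A that by auto
    interpret prob_space \<mu> using prob_measures_D[OF \<mu>] by simp
    have "\<bar>?E \<mu> h\<bar> \<le> \<bar>c h\<bar>" for h
    proof (cases "h \<in> bcont X")
      case True
      have "\<bar>\<integral>x. h x \<partial>\<mu>\<bar> \<le> (\<integral>x. \<bar>h x\<bar> \<partial>\<mu>)" by (rule integral_abs_bound)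
      also have "\<dots> \<le> (\<integral>x. c h \<partial>\<mu>)"
        using bcont_integrable[OF \<mu> True] c(1)[OF True]
        by (intro integral_mono) (auto simp: prob_measures_D[OF \<mu>])
      finally show ?thesis using True prob_space by (simp add: integrals_def)
    qed (simp add: integrals_def)
    then have "- \<bar>c h\<bar> \<le> ?E \<mu> h \<and> ?E \<mu> h \<le> \<bar>c h\<bar>" for h
      by (meson abs_le_D1 abs_le_D2 minus_le_iff)
    then show ?thesis by (simp add: S_def PiE_UNIV_domain)
  qed
  then have "F \<subseteq> S"
    unfolding F_def using cS by (intro closure_minimal) auto
  then have F: "compact F"
    using S compact_Int_closed[OF S, of F] by (simp add: F_def Int_absorb1)
  have EC: "?E ` ?C \<subseteq> F"
    using continuous_map_image_closure_subset[OF continuous_map_integrals, of X A] by (simp add: F_def)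
  have CP: "?C \<subseteq> prob_measures X"
    using closure_of_subset_topspace[of "weak_topology X" A] by (simp add: topspace_weak_topology)
  have "compactin (weak_topology X) ?C"
    unfolding compactin_def topspace_weak_topology
  proof (intro conjI allI impI CP)
    fix \<U> assume U: "Ball \<U> (openin (weak_topology X)) \<and> ?C \<subseteq> \<Union>\<U>"
    then have "\<forall>U\<in>\<U>. \<exists>V. open V \<and> U = {\<mu> \<in> prob_measures X. ?E \<mu> \<in> V}"
      by (intro ballI openin_weak_topologyD) simp
    from bchoice[OF this] obtain V where V: "\<And>U. U \<in> \<U> \<Longrightarrow> open (V U)"
      "\<And>U. U \<in> \<U> \<Longrightarrow> U = {\<mu> \<in> prob_measures X. ?E \<mu> \<in> V U}" by blast
    have "F \<subseteq> (\<Union>U\<in>\<U>. V U)"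
    proof
      fix l assume l: "l \<in> F"
      then obtain \<mu> where \<mu>: "\<mu> \<in> prob_measures X" "l = ?E \<mu>" using cl by (auto simp: F_def)
      have "\<mu> \<in> ?C"
        unfolding in_closure_of topspace_weak_topology
      proof (intro conjI allI impI \<mu>(1))
        fix T assume T: "\<mu> \<in> T \<and> openin (weak_topology X) T"
        then obtain W where W: "open W" "T = {\<mu> \<in> prob_measures X. ?E \<mu> \<in> W}"
          using openin_weak_topologyD[of X T] by blast
        then have "W \<inter> closure (?E ` A) \<noteq> {}" using l T \<mu>(2) by (auto simp: F_def)
        then have "W \<inter> ?E ` A \<noteq> {}" using open_Int_closure_eq_empty[OF W(1)] by blast
        then show "\<exists>y. y \<in> A \<and> y \<in> T" using W(2) A by auto
      qed
      then obtain U where "U \<in> \<U>" "\<mu> \<in> U" using U by blast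
      then show "l \<in> (\<Union>U\<in>\<U>. V U)" using V(2)[of U] \<mu>(2) by blast
    qed
    then obtain \<D> where D: "\<D> \<subseteq> \<U>" "finite \<D>" "F \<subseteq> (\<Union>U\<in>\<D>. V U)"
      using compactE_image[OF F, of \<U> V] V(1) by metis
    have "?C \<subseteq> \<Union>\<D>"
    proof
      fix \<mu> assume \<mu>: "\<mu> \<in> ?C"
      then obtain U where "U \<in> \<D>" "?E \<mu> \<in> V U" using EC D(3) by blast
      then show "\<mu> \<in> \<Union>\<D>" using V(2)[of U] D(1) CP \<mu> by blast
    qed
    then show "\<exists>\<F>. finite \<F> \<and> \<F> \<subseteq> \<U> \<and> ?C \<subseteq> \<Union>\<F>" using D by blast
  qed
  then show ?thesis using A by (simp add: relatively_compactin_def topspace_weak_topology)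
qed

text \<open>On the compact set \<open>K\<close> Dini's theorem makes \<open>h n\<close> small, and \<open>V\<close> has small mass while \<open>h n \<le> c\<close>.
  This uniform smallness is inherited by limit functionals, which gives them smoothness.\<close>
lemma tight_imp_uniformly_small:
  fixes h :: "nat \<Rightarrow> 'b \<Rightarrow> real"
  assumes A: "A \<subseteq> prob_measures X"
    and tight: "\<And>e. 0 < e \<Longrightarrow> \<exists>K V. compactin X K \<and> V \<in> sets (borel_of X) \<and> topspace X \<subseteq> K \<union> V \<and>
      (\<forall>\<mu>\<in>A. measure \<mu> V \<le> e)"
    and h: "\<And>n. h n \<in> bcont X"
    and dec: "\<And>n x. x \<in> topspace X \<Longrightarrow> h (Suc n) x \<le> h n x"
    and lim: "\<And>x. x \<in> topspace X \<Longrightarrow> (\<lambda>n. h n x) \<longlonglongrightarrow> 0"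
    and e: "0 < e"
  shows "\<exists>N. \<forall>n\<ge>N. \<forall>\<mu>\<in>A. (\<integral>x. h n x \<partial>\<mu>) \<le> e"
proof -
  obtain c where c: "0 < c" "\<And>x. x \<in> topspace X \<Longrightarrow> \<bar>h 0 x\<bar> \<le> c" using bcontE[OF h] by blast
  \<comment> \<open>The bound is \<open>d\<close> from \<open>K\<close> plus \<open>c d\<close> from \<open>V\<close>.\<close>
  define d where "d = e / (1 + c)"
  have d: "0 < d" using e c(1) by (simp add: d_def)
  obtain K V where K: "compactin X K" "V \<in> sets (borel_of X)" "topspace X \<subseteq> K \<union> V"
    "\<And>\<mu>. \<mu> \<in> A \<Longrightarrow> measure \<mu> V \<le> d" using tight[OF d] by blast
  have KX: "K \<subseteq> topspace X" using K(1) by (rule compactin_subset_topspace)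
  obtain N where N: "\<And>n x. n \<ge> N \<Longrightarrow> x \<in> K \<Longrightarrow> h n x < d"
    using Dini_compactin[OF K(1) bcont_continuous[OF h] _ _ d] dec lim KX by (meson subsetD)
  have "(\<integral>x. h n x \<partial>\<mu>) \<le> e" if n: "n \<ge> N" and "\<mu> \<in> A" for n \<mu>
  proof -
    have \<mu>: "\<mu> \<in> prob_measures X" using A that by auto
    interpret prob_space \<mu> using prob_measures_D[OF \<mu>] by simp
    have V: "V \<in> sets \<mu>" using K(2) by (simp add: prob_measures_D[OF \<mu>])
    have iV: "integrable \<mu> (\<lambda>x. c * indicator V x)"
      by (intro integrable_mult_right integrable_const_bound[where B=1] borel_measurable_indicator V) auto
    have "h n x \<le> d + c * indicator V x" if x: "x \<in> topspace X" for x
    proof (cases "x \<in> V")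
      case True
      have "h n x \<le> h 0 x" using lift_Suc_antimono_le[of "\<lambda>n. h n x" 0 n] dec[OF x] by blast
      also have "\<dots> \<le> c" using c(2)[OF x] by simp
      finally show ?thesis using True d by simp
    next
      case False
      then have "x \<in> K" using K(3) x by auto
      then show ?thesis using N[OF n] False by (simp add: less_imp_le)
    qed
    then have "(\<integral>x. h n x \<partial>\<mu>) \<le> (\<integral>x. d + c * indicator V x \<partial>\<mu>)"
      by (intro integral_mono bcont_integrable[OF \<mu> h] Bochner_Integration.integrable_add iV)
        (auto simp: prob_measures_D[OF \<mu>])
    also have "\<dots> = d + c * measure \<mu> V"
      using iV V sets.sets_into_space[OF V] by (simp add: prob_space Int_absorb2)
    also have "\<dots> \<le> d + c * d" using K(4)[OF \<open>\<mu> \<in> A\<close>] c(1) by simp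
    also have "\<dots> = d * (1 + c)" by (simp add: algebra_simps)
    also have "\<dots> = e" using c(1) by (simp add: d_def)
    finally show ?thesis .
  qed
  then show ?thesis by blast
qed

lemma closure_subset_closed_property:
  fixes S :: "'t::topological_space set"
  assumes "l \<in> closure S" "closed {l. P l}" "\<And>x. x \<in> S \<Longrightarrow> P x"
  shows "P l"
  using closure_minimal[of S "{l. P l}"] assms by auto

text \<open>Prokhorov's theorem. \<open>V\<close> is a measurable cover of the complement of \<open>K\<close>, so that \<open>K\<close> itself
  may fail to be closed or measurable.\<close>
theorem tight_imp_relatively_compact:
  fixes X :: "'b topology"
  assumes cz: "cozero_space X" and A: "A \<subseteq> prob_measures X"
    and tight: "\<And>e. 0 < e \<Longrightarrow> \<exists>K V. compactin X K \<and> V \<in> sets (borel_of X) \<and> topspace X \<subseteq> K \<union> V \<and>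
      (\<forall>\<mu>\<in>A. measure \<mu> V \<le> e)"
  shows "relatively_compactin (weak_topology X) A"
proof (rule relatively_compact_weakI[OF A], rule subsetI)
  fix L assume L: "L \<in> closure (integrals X ` A)"
  have coord: "continuous_on UNIV (\<lambda>l :: ('b \<Rightarrow> real) \<Rightarrow> real. l h)" for h
    by (rule continuous_on_product_coordinates)
  have int: "integrable \<mu> h" if "\<mu> \<in> A" "h \<in> bcont X" for \<mu> h
    using that A bcont_integrable by blast
  \<comment> \<open>Each axiom is a closed condition on \<open>L\<close> in the product topology and holds for the integrals
    against members of \<open>A\<close>.\<close>
  interpret daniell_functional X L
  proof
    show "cozero_space X" by fact
  next
    fix h g assume hg: "h \<in> bcont X" "g \<in> bcont X"
    show "L (\<lambda>x. h x + g x) = L h + L g"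
      using L by (rule closure_subset_closed_property)
        (auto intro!: closed_Collect_eq continuous_on_add coord simp: integrals_def hg bcont_add int)
  next
    fix c h assume h: "h \<in> bcont X"
    show "L (\<lambda>x. c * h x) = c * L h"
      using L by (rule closure_subset_closed_property)
        (auto intro!: closed_Collect_eq continuous_intros coord simp: integrals_def h bcont_cmult)
  next
    fix h assume h: "h \<in> bcont X" "\<And>x. x \<in> topspace X \<Longrightarrow> 0 \<le> h x"
    have "0 \<le> integrals X \<mu> h" if "\<mu> \<in> A" for \<mu>
      using h prob_measures_D(2)[of \<mu> X] A that unfolding integrals_def
      by (auto intro!: Bochner_Integration.integral_nonneg)
    then show "0 \<le> L h"
      using L by (intro closure_subset_closed_property[OF L, of "\<lambda>l. 0 \<le> l h"])
        (auto intro!: closed_Collect_le continuous_on_const coord)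
  next
    have "integrals X \<mu> (\<lambda>_. 1) = 1" if "\<mu> \<in> A" for \<mu>
      using prob_space.prob_space[OF prob_measures_D(3)[of \<mu> X]] A that
      by (auto simp: integrals_def bcont_const)
    then show "L (\<lambda>_. 1) = 1"
      by (intro closure_subset_closed_property[OF L, of "\<lambda>l. l (\<lambda>_. 1) = 1"])
        (auto intro!: closed_Collect_eq continuous_on_const coord)
  next
    fix h :: "nat \<Rightarrow> 'b \<Rightarrow> real"
    assume h: "\<And>n. h n \<in> bcont X" "\<And>n x. x \<in> topspace X \<Longrightarrow> h (Suc n) x \<le> h n x"
      "\<And>x. x \<in> topspace X \<Longrightarrow> (\<lambda>n. h n x) \<longlonglongrightarrow> 0"
    have nonneg: "0 \<le> h n x" if "x \<in> topspace X" for n x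
      by (rule decseq_ge[OF decseq_SucI h(3)[OF that]]) (simp add: h that)
    show "(\<lambda>n. L (h n)) \<longlonglongrightarrow> 0"
    proof (rule LIMSEQ_I)
      fix r :: real assume r: "0 < r"
      obtain N where N: "\<And>n \<mu>. n \<ge> N \<Longrightarrow> \<mu> \<in> A \<Longrightarrow> (\<integral>x. h n x \<partial>\<mu>) \<le> r / 2"
        using tight_imp_uniformly_small[OF A tight h, of "r / 2"] r by auto
      have "norm (L (h n) - 0) < r" if n: "n \<ge> N" for n
      proof -
        have "0 \<le> integrals X \<mu> (h n) \<and> integrals X \<mu> (h n) \<le> r / 2" if "\<mu> \<in> A" for \<mu>
          using h(1) N[OF n that] prob_measures_D(2)[of \<mu> X] A that unfolding integrals_def
          by (auto intro!: Bochner_Integration.integral_nonneg simp: nonneg)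
        then have "0 \<le> L (h n) \<and> L (h n) \<le> r / 2"
          by (intro closure_subset_closed_property[OF L, of "\<lambda>l. 0 \<le> l (h n) \<and> l (h n) \<le> r / 2"])
            (auto intro!: closed_Collect_conj closed_Collect_le continuous_on_const continuous_on_mult coord)
        then show ?thesis using r by simp
      qed
      then show "\<exists>no. \<forall>n\<ge>no. norm (L (h n) - 0) < r" by blast
    qed
  qed
  obtain \<mu> where \<mu>: "\<mu> \<in> prob_measures X" "\<And>h. h \<in> bcont X \<Longrightarrow> L h = (\<integral>x. h x \<partial>\<mu>)"
    using representation by blast
  have "L h = 0" if "h \<notin> bcont X" for h
    using L by (rule closure_subset_closed_property)
      (auto intro!: closed_Collect_eq coord continuous_on_const simp: integrals_def that)
  then have "L = integrals X \<mu>"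
    using \<mu>(2) by (auto simp: integrals_def fun_eq_iff)
  then show "L \<in> integrals X ` prob_measures X" using \<mu>(1) by blast
qed

section \<open>Cozero sets\<close>

text \<open>In a metric space the distance to the complement of \<open>U\<close> is positive exactly on \<open>U\<close>. The case
  \<open>U = UNIV\<close> is separate because the distance to the empty set is \<open>0\<close> by convention.\<close>
lemma cozero_in_vimage:
  fixes F :: "'b \<Rightarrow> 'm::metric_space"
  assumes F: "continuous_map X euclidean F" and U: "open U"
  shows "cozero_in X {x \<in> topspace X. F x \<in> U}"
proof (cases "U = UNIV")
  case True
  show ?thesis
    unfolding cozero_in_def by (rule bexI[of _ "\<lambda>_. 1"]) (simp_all add: True bcont_const)
next
  case False
  let ?u = "\<lambda>y. min 1 (infdist y (- U))"
  have "continuous_map X euclideanreal (?u \<circ> F)"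
    by (rule continuous_map_compose[OF F])
      (simp add: continuous_on_min continuous_on_infdist continuous_on_id)
  then have "?u \<circ> F \<in> bcont X"
    by (rule bcontI[where c=1]) (simp add: infdist_nonneg)
  moreover have "(0 < ?u y) = (y \<in> U)" for y
  proof -
    have "closed (- U)" "- U \<noteq> {}" using U False by auto
    from in_closed_iff_infdist_zero[OF this, of y] have "(0 < infdist y (- U)) = (y \<in> U)"
      using infdist_nonneg[of y "- U"] by auto
    then show ?thesis by simp
  qed
  ultimately show ?thesis
    unfolding cozero_in_def by (intro bexI[of _ "?u \<circ> F"]) (simp_all add: infdist_nonneg)
qed

lemma cozero_in_Int:
  assumes "cozero_in X A" "cozero_in X B"
  shows "cozero_in X (A \<inter> B)"
proof -
  obtain a where a: "a \<in> bcont X" "\<forall>x\<in>topspace X. 0 \<le> a x \<and> a x \<le> 1" "A = {x\<in>topspace X. 0 < a x}"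
    using assms(1) unfolding cozero_in_def by blast
  obtain b where b: "b \<in> bcont X" "\<forall>x\<in>topspace X. 0 \<le> b x \<and> b x \<le> 1" "B = {x\<in>topspace X. 0 < b x}"
    using assms(2) unfolding cozero_in_def by blast
  show ?thesis
    unfolding cozero_in_def
    by (rule bexI[of _ "\<lambda>x. min (a x) (b x)"]) (use a b in \<open>auto intro: bcont_min\<close>)
qed

text \<open>The functions \<open>e\<^sub>n\<close> are combined into one map to the metrizable space of real sequences, where
  the sequences with some positive entry form an open set.\<close>
lemma cozero_in_countable_Union:
  fixes A :: "nat \<Rightarrow> 'b set"
  assumes "\<And>n. cozero_in X (A n)"
  shows "cozero_in X (\<Union>n. A n)"
proof -
  have "\<forall>n. \<exists>e. e \<in> bcont X \<and> A n = {x\<in>topspace X. 0 < e x}"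
    using assms unfolding cozero_in_def by blast
  from choice[OF this] obtain e where e: "\<And>n. e n \<in> bcont X" "\<And>n. A n = {x\<in>topspace X. 0 < e n x}"
    by blast
  let ?F = "\<lambda>x n. e n x"
  have "continuous_map X (product_topology (\<lambda>_. euclideanreal) UNIV) ?F"
    by (rule continuous_map_coordinatewise_then_product) (simp_all add: e bcont_continuous)
  then have F: "continuous_map X euclidean ?F" by (simp add: euclidean_product_topology)
  have "{l :: nat \<Rightarrow> real. \<exists>n. 0 < l n} = (\<Union>n. {l. 0 < l n})" by auto
  moreover have "open \<dots>"
    by (intro open_UN ballI open_Collect_less continuous_on_const continuous_on_product_coordinates)
  ultimately have U: "open {l :: nat \<Rightarrow> real. \<exists>n. 0 < l n}" by metis
  have "(\<Union>n. A n) = {x \<in> topspace X. ?F x \<in> {l. \<exists>n. 0 < l n}}" using e(2) by auto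
  then show ?thesis using cozero_in_vimage[OF F U] by metis
qed

section \<open>Atoms of counting measures\<close>

lemma counting_measuresD:
  assumes "\<phi> \<in> counting_measures"
  shows "sets \<phi> = sets borel" "space \<phi> = UNIV"
    "\<And>B. B \<in> sets borel \<Longrightarrow> bounded B \<Longrightarrow> \<exists>k::nat. emeasure \<phi> B = of_nat k"
    "\<And>B. B \<in> sets borel \<Longrightarrow> bounded B \<Longrightarrow> emeasure \<phi> B < \<infinity>"
proof -
  show "sets \<phi> = sets borel" using assms by (simp add: counting_measures_def)
  from sets_eq_imp_space_eq[OF this] show "space \<phi> = UNIV" by simp
  show k: "\<exists>k::nat. emeasure \<phi> B = of_nat k" if "B \<in> sets borel" "bounded B" for B
    using assms that by (simp add: counting_measures_def)
  show "emeasure \<phi> B < \<infinity>" if "B \<in> sets borel" "bounded B" for B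
    using k[OF that] by (auto simp: less_top[symmetric])
qed

text \<open>The masses of shrinking balls tend to \<open>0\<close> and are integers.\<close>
lemma null_ball_of_null_point:
  fixes \<phi> :: "'a::euclidean_space measure"
  assumes \<phi>: "\<phi> \<in> counting_measures" and x: "emeasure \<phi> {x} = 0"
  shows "\<exists>e>0. emeasure \<phi> (ball x e) = 0"
proof -
  note D = counting_measuresD[OF \<phi>]
  let ?B = "\<lambda>n::nat. ball x (1 / real (Suc n))"
  have "(\<lambda>n. emeasure \<phi> (?B n)) \<longlonglongrightarrow> emeasure \<phi> (\<Inter>n. ?B n)"
  proof (rule Lim_emeasure_decseq)
    show "range ?B \<subseteq> sets \<phi>" by (auto simp: D)
    show "decseq ?B"
      by (intro decseq_SucI subset_ball) (simp add: frac_le)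
    show "emeasure \<phi> (?B n) \<noteq> \<infinity>" for n using D(4)[of "?B n"] by auto
  qed
  moreover have "(\<Inter>n. ?B n) = {x}"
  proof (intro equalityI subsetI)
    fix y assume y: "y \<in> (\<Inter>n. ?B n)"
    show "y \<in> {x}"
    proof (rule ccontr)
      assume "y \<notin> {x}"
      then have "0 < dist x y" by simp
      then obtain n where "1 / real (Suc n) < dist x y" using nat_approx_posE by blast
      then show False using y by (auto simp: not_less[symmetric] dest!: spec[of _ n])
    qed
  qed auto
  ultimately have "(\<lambda>n. emeasure \<phi> (?B n)) \<longlonglongrightarrow> 0" using x by simp
  then have "\<forall>\<^sub>F n in sequentially. emeasure \<phi> (?B n) < 1"
    by (rule order_tendstoD) simp
  then obtain n where n: "emeasure \<phi> (?B n) < 1" by (auto simp: eventually_sequentially)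
  obtain k :: nat where k: "emeasure \<phi> (?B n) = of_nat k" using D(3)[of "?B n"] by auto
  then have "k = 0" using n by (simp add: ennreal_of_nat_eq_real_of_nat ennreal_less_one_iff)
  then show ?thesis using k by (intro exI[of _ "1 / real (Suc n)"]) simp
qed

text \<open>By \<open>null_ball_of_null_point\<close> the set is covered by open null sets, and countably many of them
  suffice.\<close>
lemma counting_measure_null_if_no_atoms:
  fixes \<phi> :: "'a::euclidean_space measure"
  assumes \<phi>: "\<phi> \<in> counting_measures" and D: "D \<in> sets borel" "\<And>x. x \<in> D \<Longrightarrow> emeasure \<phi> {x} = 0"
  shows "emeasure \<phi> D = 0"
proof -
  let ?\<F> = "{U. open U \<and> emeasure \<phi> U = 0}"
  obtain \<F>' where F: "\<F>' \<subseteq> ?\<F>" "countable \<F>'" "\<Union>\<F>' = \<Union>?\<F>"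
    by (rule Lindelof[of ?\<F>]) auto
  have "D \<subseteq> \<Union>?\<F>"
  proof
    fix x assume "x \<in> D"
    then obtain e where "e > 0" "emeasure \<phi> (ball x e) = 0"
      using null_ball_of_null_point[OF \<phi>] D(2) by blast
    then show "x \<in> \<Union>?\<F>" by (auto intro!: exI[of _ "ball x e"])
  qed
  moreover have "(\<Union>U\<in>\<F>'. U) \<in> null_sets \<phi>"
    using F by (intro null_sets_UN') (auto simp: null_sets_def counting_measuresD[OF \<phi>])
  ultimately show ?thesis
    using F(3) emeasure_mono[of D "\<Union>\<F>'" \<phi>] by (auto simp: null_sets_def)
qed

text \<open>Induction on the mass of \<open>D\<close>: if it is positive there is an atom in \<open>D\<close>, which is removed and
  listed with its multiplicity.\<close>
lemma counting_measure_enumeration: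
  fixes \<phi> :: "'a::euclidean_space measure"
  assumes \<phi>: "\<phi> \<in> counting_measures" and D: "D \<in> sets borel" "bounded D"
  shows "\<exists>xs. set xs \<subseteq> D \<and>
    (\<forall>B\<in>sets borel. emeasure \<phi> (D \<inter> B) = of_nat (length (filter (\<lambda>y. y \<in> B) xs)))"
proof -
  note C = counting_measuresD[OF \<phi>]
  have "emeasure \<phi> D = of_nat n \<Longrightarrow> ?thesis" for n
    using D
  proof (induction n arbitrary: D rule: less_induct)
    case (less n)
    show ?case
    proof (cases "\<exists>x\<in>D. emeasure \<phi> {x} \<noteq> 0")
      case False
      have 0: "emeasure \<phi> D = 0"
      proof (rule counting_measure_null_if_no_atoms[OF \<phi>])
        show "D \<in> sets borel" by (rule less.prems)
        show "emeasure \<phi> {x} = 0" if "x \<in> D" for x using False that by blast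
      qed
      have "emeasure \<phi> (D \<inter> B) = 0" if "B \<in> sets borel" for B
        using emeasure_mono[of "D \<inter> B" D \<phi>] less.prems 0 by (simp add: C)
      then show ?thesis by (intro exI[of _ "[]"]) simp
    next
      case True
      then obtain x where x: "x \<in> D" "emeasure \<phi> {x} \<noteq> 0" by blast
      obtain m :: nat where m: "emeasure \<phi> {x} = of_nat m" using C(3)[of "{x}"] by auto
      have D': "D - {x} \<in> sets borel" "bounded (D - {x})"
        using less.prems bounded_subset[of D "D - {x}"] by auto
      obtain n' :: nat where n': "emeasure \<phi> (D - {x}) = of_nat n'" using C(3)[OF D'] by auto
      have split: "emeasure \<phi> (D \<inter> B) = emeasure \<phi> ({x} \<inter> B) + emeasure \<phi> ((D - {x}) \<inter> B)"
        if "B \<in> sets borel" for B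
      proof -
        have "D \<inter> B = ({x} \<inter> B) \<union> ((D - {x}) \<inter> B)" using x by auto
        moreover have "({x} \<inter> B) \<inter> ((D - {x}) \<inter> B) = {}" by auto
        moreover have "{x} \<inter> B \<in> sets \<phi>" "(D - {x}) \<inter> B \<in> sets \<phi>"
          using that D' by (auto simp: C)
        ultimately show ?thesis by (simp add: plus_emeasure)
      qed
      have "of_nat n = (of_nat (m + n') :: ennreal)"
        using split[of UNIV] m n' less.prems(1) by simp
      then have "n = m + n'" by (simp only: of_nat_eq_iff)
      then have "n' < n" using m x(2) by (cases m) auto
      from less.IH[OF this n' D'] obtain xs where xs: "set xs \<subseteq> D - {x}"
        "\<And>B. B \<in> sets borel \<Longrightarrow> emeasure \<phi> ((D - {x}) \<inter> B) = of_nat (length (filter (\<lambda>y. y \<in> B) xs))"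
        by blast
      have "emeasure \<phi> (D \<inter> B) = of_nat (length (filter (\<lambda>y. y \<in> B) (replicate m x @ xs)))"
        if B: "B \<in> sets borel" for B
        using split[OF B] xs(2)[OF B] m by (cases "x \<in> B") simp_all
      then show ?thesis using xs(1) x(1) by (intro exI[of _ "replicate m x @ xs"]) auto
    qed
  qed
  then show ?thesis using C(3)[OF D] by blast
qed

section \<open>The vague topology\<close>

definition test_function :: "('a::euclidean_space \<Rightarrow> real) \<Rightarrow> bool" where
  "test_function g \<longleftrightarrow> continuous_on UNIV g \<and> compact (closure {x. g x \<noteq> 0})"

lemma test_functionE:
  fixes g :: "'a::euclidean_space \<Rightarrow> real"
  assumes "test_function g"
  obtains m :: nat and c where "\<And>x. real m \<le> norm x \<Longrightarrow> g x = 0" "\<And>x. \<bar>g x\<bar> \<le> c"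
proof -
  have cp: "compact (closure {x. g x \<noteq> 0})" and cont: "continuous_on UNIV g"
    using assms by (auto simp: test_function_def)
  obtain a where a: "\<And>x. x \<in> closure {x. g x \<noteq> 0} \<Longrightarrow> norm x \<le> a"
    using compact_imp_bounded[OF cp] unfolding bounded_iff by blast
  obtain m :: nat where m: "a < real m" using reals_Archimedean2 by blast
  have 1: "g x = 0" if x: "real m \<le> norm x" for x
  proof (rule ccontr)
    assume "g x \<noteq> 0"
    then have "x \<in> closure {x. g x \<noteq> 0}" by (intro subsetD[OF closure_subset] CollectI)
    from a[OF this] m x show False by simp
  qed
  have "compact (g ` closure {x. g x \<noteq> 0})"
    by (rule compact_continuous_image[OF continuous_on_subset[OF cont subset_UNIV] cp])
  from compact_imp_bounded[OF this] obtain c where c: "\<And>x. x \<in> closure {x. g x \<noteq> 0} \<Longrightarrow> \<bar>g x\<bar> \<le> c"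
    unfolding bounded_iff by auto
  have "\<bar>g x\<bar> \<le> max c 0" for x
  proof (cases "g x = 0")
    case False
    then have "x \<in> closure {x. g x \<noteq> 0}" by (intro subsetD[OF closure_subset] CollectI)
    from c[OF this] show ?thesis by simp
  qed simp
  with 1 show ?thesis by (rule that)
qed

lemma test_functionI:
  fixes g :: "'a::euclidean_space \<Rightarrow> real"
  assumes "continuous_on UNIV g" "\<And>x. R \<le> norm x \<Longrightarrow> g x = 0"
  shows "test_function g"
proof -
  have "{x. g x \<noteq> 0} \<subseteq> cball 0 R" using assms(2) by (force simp: not_le)
  then have "bounded {x. g x \<noteq> 0}" using bounded_subset bounded_cball by blast
  then show ?thesis using assms(1) by (simp add: test_function_def compact_closure)
qed

lemma test_function_borel: "test_function g \<Longrightarrow> g \<in> borel_measurable borel"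
  by (simp add: test_function_def borel_measurable_continuous_onI)

lemma test_function_integrable:
  fixes g :: "'a::euclidean_space \<Rightarrow> real"
  assumes \<phi>: "\<phi> \<in> counting_measures" and g: "test_function g"
  shows "integrable \<phi> g"
proof -
  note C = counting_measuresD[OF \<phi>]
  obtain m :: nat and c where m: "\<And>x. real m \<le> norm x \<Longrightarrow> g x = 0" "\<And>x. \<bar>g x\<bar> \<le> c"
    using test_functionE[OF g] by blast
  have gm: "g \<in> borel_measurable \<phi>"
    using test_function_borel[OF g] measurable_cong_sets[OF C(1) refl] by blast
  show ?thesis
  proof (rule integrableI_bounded_set[where A="ball 0 (real m)" and B=c])
    show "ball 0 (real m) \<in> sets \<phi>" by (simp add: C)
    show "emeasure \<phi> (ball 0 (real m)) < \<infinity>" by (rule C(4)) auto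
  qed (use m gm in auto)
qed

lemma topspace_vague_topology:
  "topspace vague_topology = (counting_measures :: 'a::euclidean_space measure set)"
proof -
  have "counting_measures \<in> {{\<phi> \<in> counting_measures. (\<integral>x. g x \<partial>\<phi>) \<in> U} | (g :: 'a \<Rightarrow> real) U.
        continuous_on UNIV g \<and> compact (closure {x. g x \<noteq> 0}) \<and> open U}"
    by (intro CollectI exI[of _ "\<lambda>_. 0"] exI[of _ UNIV] conjI) simp_all
  then show ?thesis unfolding vague_topology_def topology_generated_by_topspace by blast
qed

lemma openin_vague_basic:
  fixes g :: "'a::euclidean_space \<Rightarrow> real"
  assumes "test_function g" "open U"
  shows "openin vague_topology {\<phi> \<in> counting_measures. (\<integral>x. g x \<partial>\<phi>) \<in> U}"
  unfolding vague_topology_def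
proof (rule topology_generated_by_Basis)
  show "{\<phi> \<in> counting_measures. (\<integral>x. g x \<partial>\<phi>) \<in> U} \<in>
     {{\<phi> \<in> counting_measures. (\<integral>x. g x \<partial>\<phi>) \<in> U} | (g :: 'a \<Rightarrow> real) U.
        continuous_on UNIV g \<and> compact (closure {x. g x \<noteq> 0}) \<and> open U}"
    using assms by (intro CollectI exI[of _ g] exI[of _ U] conjI) (simp_all add: test_function_def)
qed

lemma continuous_integral_vague:
  assumes "test_function g"
  shows "continuous_map vague_topology euclideanreal (\<lambda>\<phi>. \<integral>x. g x \<partial>\<phi>)"
  unfolding continuous_map_def topspace_vague_topology
  using openin_vague_basic[OF assms] by simp

lemma continuous_map_into_vague:
  fixes F :: "'b \<Rightarrow> 'a::euclidean_space measure"
  assumes "\<And>x. x \<in> topspace T \<Longrightarrow> F x \<in> counting_measures"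
    and "\<And>(g :: 'a \<Rightarrow> real) U. test_function g \<Longrightarrow> open U \<Longrightarrow> openin T {x \<in> topspace T. (\<integral>y. g y \<partial>F x) \<in> U}"
  shows "continuous_map T vague_topology F"
  unfolding vague_topology_def continuous_on_generated_topo_iff
proof (intro conjI allI impI)
  show "F ` topspace T \<subseteq> \<Union>{{\<phi> \<in> counting_measures. (\<integral>x. g x \<partial>\<phi>) \<in> U} | (g :: 'a \<Rightarrow> real) U.
        continuous_on UNIV g \<and> compact (closure {x. g x \<noteq> 0}) \<and> open U}"
    using assms(1) topspace_vague_topology
    unfolding vague_topology_def topology_generated_by_topspace by blast
next
  fix V assume "V \<in> {{\<phi> \<in> counting_measures. (\<integral>x. g x \<partial>\<phi>) \<in> U} | (g :: 'a \<Rightarrow> real) U.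
        continuous_on UNIV g \<and> compact (closure {x. g x \<noteq> 0}) \<and> open U}"
  then obtain g U where V: "V = {\<phi> \<in> counting_measures. (\<integral>x. g x \<partial>\<phi>) \<in> U}" "test_function g" "open U"
    unfolding test_function_def by blast
  have "F -` V \<inter> topspace T = {x \<in> topspace T. (\<integral>y. g y \<partial>F x) \<in> U}"
    using assms(1) V(1) by auto
  then show "openin T (F -` V \<inter> topspace T)" using assms(2)[OF V(2,3)] by simp
qed

section \<open>Counting measures as sequences of points\<close>

definition annulus :: "nat \<Rightarrow> 'a::euclidean_space set" where
  "annulus k = {x. real k \<le> norm x \<and> norm x \<le> real k + 1}"

text \<open>A parameter \<open>(x, r)\<close> stands for the points \<open>x (k, j)\<close> with \<open>j < r k\<close>. The entries with \<open>j \<ge> r k\<close> are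
  idle, but confining them to the annulus as well makes the parameters with bounded \<open>r\<close> a compact set.
  The annuli are closed for the same reason; this lets neighbouring annuli overlap, which is
  harmless as points are counted by slots.\<close>
definition params :: "((nat \<times> nat \<Rightarrow> 'a::euclidean_space) \<times> (nat \<Rightarrow> nat)) set" where
  "params = {p. \<forall>k j. fst p (k, j) \<in> annulus k}"

definition slots :: "(nat \<Rightarrow> nat) \<Rightarrow> (nat \<times> nat) set" where
  "slots r = {(k, j). j < r k}"

definition config :: "(nat \<times> nat \<Rightarrow> 'a::euclidean_space) \<times> (nat \<Rightarrow> nat) \<Rightarrow> 'a measure" where
  "config p = distr (count_space (slots (snd p))) borel (fst p)"

text \<open>A point in slot \<open>(k, j)\<close> has norm at least \<open>k\<close>. This is the source of local finiteness.\<close>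
lemma slots_in_ball:
  assumes p: "p \<in> params" and B: "B \<subseteq> ball 0 (real m)"
  shows "{s \<in> slots (snd p). fst p s \<in> B} \<subseteq> (SIGMA k:{..<m}. {..<snd p k})"
proof
  fix s assume "s \<in> {s \<in> slots (snd p). fst p s \<in> B}"
  then obtain k j where s: "s = (k, j)" "j < snd p k" "fst p (k, j) \<in> B" by (auto simp: slots_def)
  have "real k \<le> norm (fst p (k, j))" using p by (simp add: params_def annulus_def)
  also have "\<dots> < real m" using s(3) B by auto
  finally show "s \<in> (SIGMA k:{..<m}. {..<snd p k})" using s by simp
qed

lemma emeasure_config:
  assumes "B \<in> sets borel"
  shows "emeasure (config p) B = emeasure (count_space (slots (snd p))) {s \<in> slots (snd p). fst p s \<in> B}"
proof -
  have "fst p -` B \<inter> slots (snd p) = {s \<in> slots (snd p). fst p s \<in> B}" by auto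
  then show ?thesis using assms unfolding config_def by (subst emeasure_distr) auto
qed

lemma emeasure_config_bounded:
  assumes p: "p \<in> params" and B: "B \<in> sets borel" "bounded B"
  shows "finite {s \<in> slots (snd p). fst p s \<in> B}"
    "emeasure (config p) B = of_nat (card {s \<in> slots (snd p). fst p s \<in> B})"
proof -
  obtain a where a: "\<And>x. x \<in> B \<Longrightarrow> norm x \<le> a" using B(2) unfolding bounded_iff by blast
  obtain m :: nat where m: "a < real m" using reals_Archimedean2 by blast
  have "B \<subseteq> ball 0 (real m)" using le_less_trans[OF a m] by auto
  from slots_in_ball[OF p this] show fin: "finite {s \<in> slots (snd p). fst p s \<in> B}"
    by (rule finite_subset) auto
  then show "emeasure (config p) B = of_nat (card {s \<in> slots (snd p). fst p s \<in> B})"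
    using B by (simp add: emeasure_config emeasure_count_space_finite)
qed

lemma config_counting:
  assumes "p \<in> params"
  shows "config p \<in> counting_measures"
  using emeasure_config_bounded(2)[OF assms]
  unfolding counting_measures_def by (auto simp: config_def)

lemma integral_config:
  fixes g :: "'a::euclidean_space \<Rightarrow> real"
  assumes p: "p \<in> params" and g: "g \<in> borel_measurable borel" "\<And>x. real m \<le> norm x \<Longrightarrow> g x = 0"
  shows "(\<integral>x. g x \<partial>config p) = (\<Sum>k<m. \<Sum>j<snd p k. g (fst p (k, j)))"
proof -
  let ?S = "slots (snd p)" and ?I = "SIGMA k:{..<m}. {..<snd p k}"
  have sub: "{s \<in> ?S. g (fst p s) \<noteq> 0} \<subseteq> ?I"
  proof -
    have "{s \<in> ?S. g (fst p s) \<noteq> 0} \<subseteq> {s \<in> ?S. fst p s \<in> ball 0 (real m)}"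
      using g(2) by (auto simp: not_le[symmetric])
    also have "\<dots> \<subseteq> ?I" by (rule slots_in_ball[OF p]) simp
    finally show ?thesis .
  qed
  have "(\<integral>x. g x \<partial>config p) = (\<integral>s. g (fst p s) \<partial>count_space ?S)"
    unfolding config_def using g(1) by (intro integral_distr) simp_all
  also have "\<dots> = (\<Sum>s | s \<in> ?S \<and> g (fst p s) \<noteq> 0. g (fst p s))"
    using finite_subset[OF sub] by (intro lebesgue_integral_count_space_finite_support) auto
  also have "\<dots> = (\<Sum>s\<in>?I. g (fst p s))"
    using sub by (intro sum.mono_neutral_left) (auto simp: slots_def)
  also have "\<dots> = (\<Sum>k<m. \<Sum>j<snd p k. g (fst p (k, j)))"
    by (subst sum.Sigma) (auto simp: case_prod_unfold)
  finally show ?thesis .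
qed

text \<open>The number of summands is a coordinate in a discrete space, hence locally constant.\<close>
lemma continuous_on_slot_sum:
  fixes g :: "'a::euclidean_space \<Rightarrow> real"
  assumes g: "continuous_on UNIV g"
  shows "continuous_on UNIV (\<lambda>p :: (nat \<times> nat \<Rightarrow> 'a) \<times> (nat \<Rightarrow> nat). \<Sum>j<snd p k. g (fst p (k, j)))"
  unfolding continuous_on_def
proof
  fix p0 :: "(nat \<times> nat \<Rightarrow> 'a) \<times> (nat \<Rightarrow> nat)"
  have c1: "continuous_on UNIV (\<lambda>p :: (nat \<times> nat \<Rightarrow> 'a) \<times> (nat \<Rightarrow> nat). snd p k)"
    by (rule continuous_on_product_then_coordinatewise[OF continuous_on_snd[OF continuous_on_id]])
  have c2: "continuous_on UNIV (\<lambda>p :: (nat \<times> nat \<Rightarrow> 'a) \<times> (nat \<Rightarrow> nat). fst p (k, j))" for j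
    by (rule continuous_on_product_then_coordinatewise[OF continuous_on_fst[OF continuous_on_id]])
  have c3: "continuous_on UNIV (\<lambda>p :: (nat \<times> nat \<Rightarrow> 'a) \<times> (nat \<Rightarrow> nat). \<Sum>j<snd p0 k. g (fst p (k, j)))"
    by (intro continuous_on_sum continuous_on_compose2[OF g] c2) auto
  have "((\<lambda>p. snd p k) \<longlongrightarrow> snd p0 k) (at p0)"
    using c1 unfolding continuous_on_def by blast
  then have ev: "\<forall>\<^sub>F p in at p0. snd p k = snd p0 k" by (simp add: tendsto_discrete)
  have "((\<lambda>p. \<Sum>j<snd p0 k. g (fst p (k, j))) \<longlongrightarrow> (\<Sum>j<snd p0 k. g (fst p0 (k, j)))) (at p0)"
    using c3 unfolding continuous_on_def by blast
  then show "((\<lambda>p. \<Sum>j<snd p k. g (fst p (k, j))) \<longlongrightarrow> (\<Sum>j<snd p0 k. g (fst p0 (k, j)))) (at p0)"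
    by (rule Lim_transform_eventually) (use ev in eventually_elim, simp)
qed

lemma continuous_config: "continuous_map (top_of_set params) vague_topology config"
proof (rule continuous_map_into_vague)
  fix g :: "'a \<Rightarrow> real" and U :: "real set"
  assume g: "test_function g" and U: "open U"
  obtain m :: nat and c where m: "\<And>x. real m \<le> norm x \<Longrightarrow> g x = 0" "\<And>x. \<bar>g x\<bar> \<le> c"
    using test_functionE[OF g] by blast
  let ?G = "\<lambda>p :: (nat \<times> nat \<Rightarrow> 'a) \<times> (nat \<Rightarrow> nat). \<Sum>k<m. \<Sum>j<snd p k. g (fst p (k, j))"
  have "open (?G -` U)"
    using g by (intro open_vimage U continuous_on_sum continuous_on_slot_sum) (simp add: test_function_def)
  moreover have "{p \<in> params. (\<integral>y. g y \<partial>config p) \<in> U} = params \<inter> ?G -` U"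
    using integral_config[OF _ test_function_borel[OF g] m(1)] by auto
  ultimately show "openin (top_of_set params) {p \<in> topspace (top_of_set params). (\<integral>y. g y \<partial>config p) \<in> U}"
    by (simp add: openin_open_Int)
qed (simp add: config_counting)

text \<open>Points are assigned to the half-open annuli \<open>D k\<close>, which partition the space, and enumerated in
  each of them. The bound on \<open>snd p k\<close> is
  what places configurations with bounded counts in a compact set of parameters.\<close>
lemma config_surj:
  assumes \<phi>: "\<phi> \<in> counting_measures"
  obtains p where "p \<in> params" "config p = \<phi>" "\<And>k. of_nat (snd p k) \<le> emeasure \<phi> (ball 0 (real k + 1))"
proof -
  note C = counting_measuresD[OF \<phi>]
  define D :: "nat \<Rightarrow> 'a set" where "D k = {x. real k \<le> norm x \<and> norm x < real k + 1}" for k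
  have Dball: "D k \<subseteq> ball 0 (real k + 1)" for k by (auto simp: D_def)
  have Dm: "D k \<in> sets borel" "bounded (D k)" for k
  proof -
    show "D k \<in> sets borel" unfolding D_def by measurable
    show "bounded (D k)" using Dball bounded_ball bounded_subset by blast
  qed
  have disj: "k = l" if "x \<in> D k" "x \<in> D l" for k l x
    using that unfolding D_def by simp
  have cover: "(\<Union>k. D k) = UNIV"
  proof -
    have "x \<in> D (nat \<lfloor>norm x\<rfloor>)" for x
      unfolding D_def using floor_correct[of "norm x"] by simp
    then show ?thesis by blast
  qed
  have "\<forall>k. \<exists>xs. set xs \<subseteq> D k \<and>
    (\<forall>B\<in>sets borel. emeasure \<phi> (D k \<inter> B) = of_nat (length (filter (\<lambda>y. y \<in> B) xs)))"
    using counting_measure_enumeration[OF \<phi> Dm] by blast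
  from choice[OF this] obtain xs where xs: "\<And>k. set (xs k) \<subseteq> D k"
    "\<And>k B. B \<in> sets borel \<Longrightarrow> emeasure \<phi> (D k \<inter> B) = of_nat (length (filter (\<lambda>y. y \<in> B) (xs k)))"
    by blast
  obtain b :: 'a where b: "b \<in> Basis" using nonempty_Basis by blast
  \<comment> \<open>Idle slots hold a point of norm \<open>k\<close>.\<close>
  define x where "x = (\<lambda>(k, j). if j < length (xs k) then xs k ! j else real k *\<^sub>R b)"
  define p where "p = (x, \<lambda>k. length (xs k))"
  have xD: "x (k, j) \<in> D k" if "j < length (xs k)" for k j
    using that xs(1)[of k] nth_mem[OF that] by (auto simp: x_def)
  have p: "p \<in> params"
  proof -
    have "x (k, j) \<in> annulus k" for k j
    proof (cases "j < length (xs k)")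
      case True
      from xD[OF this] show ?thesis by (simp add: D_def annulus_def)
    next
      case False
      then show ?thesis using b by (simp add: x_def annulus_def)
    qed
    then show ?thesis by (simp add: p_def params_def)
  qed
  have eq: "emeasure (config p) (D k \<inter> B) = emeasure \<phi> (D k \<inter> B)" if B: "B \<in> sets borel" for k B
  proof -
    have "D k \<inter> B \<in> sets borel" "bounded (D k \<inter> B)" using Dm B bounded_Int by auto
    from emeasure_config_bounded(2)[OF p this]
    have "emeasure (config p) (D k \<inter> B) = of_nat (card {s \<in> slots (snd p). fst p s \<in> D k \<inter> B})" .
    also have "{s \<in> slots (snd p). fst p s \<in> D k \<inter> B} = Pair k ` {j. j < length (xs k) \<and> xs k ! j \<in> B}"
    proof (intro equalityI subsetI)
      fix s assume "s \<in> {s \<in> slots (snd p). fst p s \<in> D k \<inter> B}"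
      then obtain l j where s: "s = (l, j)" "j < length (xs l)" "x (l, j) \<in> D k" "x (l, j) \<in> B"
        by (auto simp: slots_def p_def)
      have "l = k" using disj[OF xD[OF s(2)] s(3)] .
      then show "s \<in> Pair k ` {j. j < length (xs k) \<and> xs k ! j \<in> B}" using s by (simp add: x_def)
    next
      fix s assume "s \<in> Pair k ` {j. j < length (xs k) \<and> xs k ! j \<in> B}"
      then obtain j where s: "s = (k, j)" "j < length (xs k)" "xs k ! j \<in> B" by blast
      then show "s \<in> {s \<in> slots (snd p). fst p s \<in> D k \<inter> B}"
        using xD[OF s(2)] by (simp add: slots_def p_def) (simp add: x_def)
    qed
    also have "card \<dots> = length (filter (\<lambda>y. y \<in> B) (xs k))"
      by (subst card_image) (auto simp: inj_on_def length_filter_conv_card)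
    finally show ?thesis using xs(2)[OF B] by simp
  qed
  have "config p = \<phi>"
  proof (rule measure_eqI)
    show s: "sets (config p) = sets \<phi>" by (simp add: config_def C)
    fix B assume "B \<in> sets (config p)"
    then have B: "B \<in> sets borel" by (simp add: config_def)
    have dis: "disjoint_family (\<lambda>k. D k \<inter> B)"
      using disj by (force simp: disjoint_family_on_def)
    have "(\<Sum>k. emeasure (config p) (D k \<inter> B)) = emeasure (config p) B"
      using suminf_emeasure[OF _ dis, of "config p"] Dm B by (simp add: cover config_def image_subset_iff)
    moreover have "(\<Sum>k. emeasure \<phi> (D k \<inter> B)) = emeasure \<phi> B"
      using suminf_emeasure[OF _ dis, of \<phi>] Dm B by (simp add: cover C image_subset_iff)
    ultimately show "emeasure (config p) B = emeasure \<phi> B" using eq[OF B] by simp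
  qed
  moreover have "of_nat (snd p k) \<le> emeasure \<phi> (ball 0 (real k + 1))" for k
  proof -
    have "of_nat (snd p k) = emeasure \<phi> (D k)" using xs(2)[of UNIV k] by (simp add: p_def)
    also have "\<dots> \<le> emeasure \<phi> (ball 0 (real k + 1))"
      by (rule emeasure_mono[OF Dball]) (simp add: C)
    finally show ?thesis .
  qed
  ultimately show ?thesis using p that by blast
qed

section \<open>Countability properties of the vague topology\<close>

text \<open>The preimages under \<^const>\<open>config\<close> are open in a space with a countable base, and \<^const>\<open>config\<close> is
  onto.\<close>
lemma vague_hereditarily_Lindelof:
  fixes \<U> :: "'a::euclidean_space measure set set"
  assumes U: "\<And>U. U \<in> \<U> \<Longrightarrow> openin vague_topology U"
  obtains \<V> where "\<V> \<subseteq> \<U>" "countable \<V>" "\<Union>\<V> = \<Union>\<U>"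
proof -
  let ?pre = "\<lambda>U :: 'a measure set. {p \<in> params. config p \<in> U}"
  have op: "openin (top_of_set params) (?pre U)" if "U \<in> \<U>" for U
    using openin_continuous_map_preimage[OF continuous_config U[OF that]] by simp
  have "\<exists>\<F>. \<F> \<subseteq> ?pre ` \<U> \<and> countable \<F> \<and> \<Union>\<F> = \<Union>(?pre ` \<U>)"
  proof (rule Lindelof_openin)
    show "openin (top_of_set params) S" if "S \<in> ?pre ` \<U>" for S
      using that op by (elim imageE) simp
  qed (intro exI conjI)
  then obtain \<F> where F: "\<F> \<subseteq> ?pre ` \<U>" "countable \<F>" "\<Union>\<F> = \<Union>(?pre ` \<U>)"
    by (elim exE conjE)
  have "countable \<F> \<and> \<F> \<subseteq> ?pre ` \<U>" using F by simp
  then obtain \<V> where V: "\<V> \<subseteq> \<U>" "countable \<V>" "\<F> = ?pre ` \<V>"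
    unfolding countable_subset_image by (elim exE conjE)
  have "\<Union>\<U> \<subseteq> \<Union>\<V>"
  proof
    fix \<phi> assume "\<phi> \<in> \<Union>\<U>"
    then obtain W where W: "W \<in> \<U>" "\<phi> \<in> W" by blast
    have "\<phi> \<in> counting_measures"
      using openin_subset[OF U[OF W(1)]] W(2) topspace_vague_topology by blast
    then obtain p where p: "p \<in> params" "config p = \<phi>" using config_surj by metis
    then have "p \<in> \<Union>(?pre ` \<U>)" using W by blast
    then have "p \<in> \<Union>(?pre ` \<V>)" using F(3) V(3) by simp
    then show "\<phi> \<in> \<Union>\<V>" using p(2) by blast
  qed
  then have "\<Union>\<V> = \<Union>\<U>" using Union_mono[OF V(1)] by (rule equalityI[rotated])
  then show ?thesis by (rule that[OF V(1,2)])
qed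

text \<open>Arbitrary unions in the generation of the topology become countable ones by the Lindelof
  property, so sigma-algebras and cozero sets can be treated by induction over open sets.\<close>
lemma vague_open_induct [consumes 1, case_names basic Int UN]:
  fixes G :: "'a::euclidean_space measure set"
  assumes G: "openin vague_topology G"
    and basic: "\<And>(g :: 'a \<Rightarrow> real) U. test_function g \<Longrightarrow> open U \<Longrightarrow> P {\<phi> \<in> counting_measures. (\<integral>x. g x \<partial>\<phi>) \<in> U}"
    and Int: "\<And>A B. P A \<Longrightarrow> P B \<Longrightarrow> P (A \<inter> B)"
    and UN: "\<And>A :: nat \<Rightarrow> 'a measure set. (\<And>n. P (A n)) \<Longrightarrow> P (\<Union>n. A n)"
  shows "P G"
proof -
  have empty: "P {}"
    using basic[of "\<lambda>_. 0" "{}"] test_functionI[of "\<lambda>_. 0" 0] by simp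
  have "generate_topology_on {{\<phi> \<in> counting_measures. (\<integral>x. g x \<partial>\<phi>) \<in> U} | (g :: 'a \<Rightarrow> real) U.
        continuous_on UNIV g \<and> compact (closure {x. g x \<noteq> 0}) \<and> open U} G"
    using G unfolding vague_topology_def by (rule openin_topology_generated_by)
  then have "openin vague_topology G \<and> P G"
  proof induction
    case Empty
    show ?case using empty by simp
  next
    case (Int a b)
    then show ?case using assms(3) by (simp add: openin_Int)
  next
    case (UN K)
    obtain \<V> where V: "\<V> \<subseteq> K" "countable \<V>" "\<Union>\<V> = \<Union>K"
      by (rule vague_hereditarily_Lindelof[of K]) (use UN.IH in blast)+
    have "P (\<Union>\<V>)"
    proof (cases "\<V> = {}")
      case True
      then show ?thesis using empty by simp
    next
      case False
      have "P (\<Union>n. from_nat_into \<V> n)"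
        by (rule assms(4)) (use from_nat_into[OF False] V(1) UN.IH in blast)
      then show ?thesis using range_from_nat_into[OF False V(2)] by simp
    qed
    moreover have "openin vague_topology (\<Union>K)" using UN.IH by (intro openin_Union) blast
    ultimately show ?case using V(3) by simp
  next
    case (Basis s)
    then obtain g U where "s = {\<phi> \<in> counting_measures. (\<integral>x. g x \<partial>\<phi>) \<in> U}" "test_function g" "open U"
      unfolding test_function_def by blast
    then show ?case using basic openin_vague_basic by blast
  qed
  then show ?thesis ..
qed

lemma counting_measures0_subset: "counting_measures0 \<subseteq> counting_measures"
  by (auto simp: counting_measures0_def)

lemma topspace_vague_topology0: "topspace vague_topology0 = counting_measures0"
  using counting_measures0_subset by (auto simp: vague_topology0_def topspace_vague_topology)

lemma cozero_in_vague_topology: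
  "openin vague_topology G \<Longrightarrow> cozero_in vague_topology G"
proof (induction rule: vague_open_induct)
  case (basic g U)
  from cozero_in_vimage[OF continuous_integral_vague[OF basic(1)] basic(2)]
  show ?case by (simp add: topspace_vague_topology)
next
  case (Int A B)
  then show ?case by (rule cozero_in_Int)
next
  case (UN A)
  then show ?case by (rule cozero_in_countable_Union)
qed

lemma cozero_space_vague_topology0: "cozero_space vague_topology0"
  unfolding cozero_space_def cozero_in_def
proof (intro allI impI)
  fix G :: "'a measure set" assume "openin vague_topology0 G"
  then obtain G' where G': "openin vague_topology G'" "G = G' \<inter> counting_measures0"
    by (auto simp: vague_topology0_def openin_subtopology)
  obtain e where e: "e \<in> bcont vague_topology" "\<forall>x\<in>counting_measures. 0 \<le> e x \<and> e x \<le> 1"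
    "G' = {x\<in>counting_measures. 0 < e x}"
    using cozero_in_vague_topology[OF G'(1)] unfolding cozero_in_def topspace_vague_topology by blast
  have "continuous_map vague_topology0 euclideanreal e"
    unfolding vague_topology0_def by (rule continuous_map_from_subtopology[OF bcont_continuous[OF e(1)]])
  then have "e \<in> bcont vague_topology0"
    using e(2) counting_measures0_subset
    by (intro bcontI[where c=1]) (auto simp: topspace_vague_topology0)
  then show "\<exists>e\<in>bcont vague_topology0. (\<forall>x\<in>topspace vague_topology0. 0 \<le> e x \<and> e x \<le> 1) \<and>
      G = {x \<in> topspace vague_topology0. 0 < e x}"
    using e G'(2) counting_measures0_subset unfolding topspace_vague_topology0
    by (intro bexI[of _ e]) auto
qed

lemma measurable_vague0I:
  fixes T :: "'m \<Rightarrow> 'a::euclidean_space measure"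
  assumes T: "\<And>x. x \<in> space M \<Longrightarrow> T x \<in> counting_measures0"
    and meas: "\<And>g :: 'a \<Rightarrow> real. test_function g \<Longrightarrow> (\<lambda>x. \<integral>y. g y \<partial>T x) \<in> borel_measurable M"
  shows "T \<in> measurable M (borel_of vague_topology0)"
  unfolding borel_of_def
proof (rule measurable_measure_of)
  show "T \<in> space M \<rightarrow> topspace vague_topology0" using T by (simp add: topspace_vague_topology0)
  show "{U. openin vague_topology0 U} \<subseteq> Pow (topspace (vague_topology0 :: 'a measure topology))"
    by (auto dest: openin_subset)
  fix G :: "'a measure set" assume "G \<in> {U. openin vague_topology0 U}"
  then obtain G' where G': "openin vague_topology G'" "G = G' \<inter> counting_measures0"
    by (auto simp: vague_topology0_def openin_subtopology)
  have "T -` G' \<inter> space M \<in> sets M"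
    using G'(1)
  proof (induction rule: vague_open_induct)
    case (basic g U)
    have "T -` {\<phi> \<in> counting_measures. (\<integral>x. g x \<partial>\<phi>) \<in> U} \<inter> space M = (\<lambda>x. \<integral>y. g y \<partial>T x) -` U \<inter> space M"
      using T counting_measures0_subset by auto
    then show ?case using measurable_sets[OF meas[OF basic(1)] borel_open[OF basic(2)]] by simp
  next
    case (Int A B)
    have "T -` (A \<inter> B) \<inter> space M = (T -` A \<inter> space M) \<inter> (T -` B \<inter> space M)" by auto
    then show ?case using Int by simp
  next
    case (UN A)
    have "T -` (\<Union>n. A n) \<inter> space M = (\<Union>n. T -` A n \<inter> space M)" by auto
    also have "\<dots> \<in> sets M" using UN by (intro sets.countable_UN) blast
    finally show ?case .
  qed
  moreover have "T -` G \<inter> space M = T -` G' \<inter> space M" using T G'(2) by auto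
  ultimately show "T -` G \<inter> space M \<in> sets M" by simp
qed

lemma integral_measurable_vague0:
  fixes g :: "'a::euclidean_space \<Rightarrow> real"
  assumes "test_function g"
  shows "(\<lambda>\<phi>. \<integral>x. g x \<partial>\<phi>) \<in> borel_measurable (borel_of vague_topology0)"
  unfolding vague_topology0_def
  by (intro continuous_map_borel_of continuous_map_from_subtopology continuous_integral_vague assms)

section \<open>Point counts of balls\<close>

definition cutoff :: "nat \<Rightarrow> real \<Rightarrow> 'a::euclidean_space \<Rightarrow> real" where
  "cutoff n R x = max 0 (min 1 (real n * (R - norm x)))"

lemma cutoff_bounds: "0 \<le> cutoff n R x" "cutoff n R x \<le> 1"
  by (simp_all add: cutoff_def)

lemma cutoff_eq_0:
  assumes "R \<le> norm x" shows "cutoff n R x = 0"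
proof -
  have "real n * (R - norm x) \<le> 0" using assms by (intro mult_nonneg_nonpos) simp_all
  then show ?thesis by (simp add: cutoff_def max_def min_def)
qed

lemma test_function_cutoff: "test_function (cutoff n R)"
proof (rule test_functionI[where R=R])
  show "continuous_on UNIV (cutoff n R)" unfolding cutoff_def by (intro continuous_intros)
  show "cutoff n R x = 0" if "R \<le> norm x" for x :: 'a
    using that by (rule cutoff_eq_0)
qed

lemma cutoff_tendsto: "(\<lambda>n. cutoff n R x) \<longlonglongrightarrow> indicator (ball 0 R) x"
proof (cases "norm x < R")
  case True
  then obtain m :: nat where m: "1 < real m * (R - norm x)" using reals_Archimedean3[of "R - norm x"] by auto
  have "cutoff n R x = 1" if "n \<ge> m" for n
  proof -
    have "real m * (R - norm x) \<le> real n * (R - norm x)" using that True by (intro mult_right_mono) auto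
    then show ?thesis using m by (simp add: cutoff_def)
  qed
  then have "eventually (\<lambda>n. cutoff n R x = 1) sequentially" by (rule eventually_sequentiallyI)
  then show ?thesis using True by (simp add: tendsto_eventually)
next
  case False
  then have "cutoff n R x = 0" for n by (simp add: cutoff_eq_0)
  then show ?thesis using False by simp
qed

lemma cutoff_le_indicator: "cutoff n R x \<le> indicator (ball 0 R) x"
  by (cases "norm x < R") (simp_all add: cutoff_bounds cutoff_eq_0)

text \<open>The cutoff functions increase to the indicator of the ball.\<close>
lemma measure_ball_measurable_vague0:
  "(\<lambda>\<phi>. measure \<phi> (ball (0::'a::euclidean_space) R)) \<in> borel_measurable (borel_of vague_topology0)"
proof (rule borel_measurable_LIMSEQ_real)
  show "(\<lambda>\<phi>. \<integral>x. cutoff n R (x::'a) \<partial>\<phi>) \<in> borel_measurable (borel_of vague_topology0)" for n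
    by (rule integral_measurable_vague0[OF test_function_cutoff])
  fix \<phi> :: "'a measure" assume "\<phi> \<in> space (borel_of vague_topology0)"
  then have \<phi>: "\<phi> \<in> counting_measures" using counting_measures0_subset by (auto simp: topspace_vague_topology0)
  note C = counting_measuresD[OF \<phi>]
  have "(\<lambda>n. \<integral>x. cutoff n R x \<partial>\<phi>) \<longlonglongrightarrow> (\<integral>x. indicator (ball 0 R) x \<partial>\<phi>)"
  proof (rule integral_dominated_convergence[where w="indicator (ball 0 R)"])
    show "integrable \<phi> (indicator (ball 0 R) :: 'a \<Rightarrow> real)"
      using C(4)[of "ball 0 R"] by (simp add: C)
    then show "(indicator (ball 0 R) :: 'a \<Rightarrow> real) \<in> borel_measurable \<phi>" by blast
    show "cutoff n R \<in> borel_measurable \<phi>" for n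
      using test_function_integrable[OF \<phi> test_function_cutoff] by blast
    show "AE x in \<phi>. norm (cutoff n R x) \<le> indicator (ball 0 R) x" for n
      by (rule AE_I2) (simp only: real_norm_def abs_of_nonneg[OF cutoff_bounds(1)] cutoff_le_indicator)
  qed (simp_all add: C cutoff_tendsto)
  then show "(\<lambda>n. \<integral>x. cutoff n R x \<partial>\<phi>) \<longlonglongrightarrow> measure \<phi> (ball 0 R)" by (simp add: C)
qed

section \<open>Configurations with a point at the origin\<close>

text \<open>A configuration without a point at \<open>0\<close> has none in some ball around \<open>0\<close>. A test function with
  value \<open>1\<close> at \<open>0\<close> and support in this ball then integrates to \<open>0\<close>, whereas its integral is at least \<open>1\<close>
  for any configuration with a point at \<open>0\<close>.\<close>
lemma closedin_counting_measures0: "closedin vague_topology (counting_measures0 :: 'a::euclidean_space measure set)"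
  unfolding closedin_def topspace_vague_topology
proof (intro conjI counting_measures0_subset)
  show "openin vague_topology (counting_measures - counting_measures0 :: 'a measure set)"
  proof (subst openin_subopen, intro ballI)
    fix \<phi> :: "'a measure" assume "\<phi> \<in> counting_measures - counting_measures0"
    then have \<phi>: "\<phi> \<in> counting_measures" "emeasure \<phi> {0} = 0" by (auto simp: counting_measures0_def)
    obtain e where e: "e > 0" "emeasure \<phi> (ball 0 e) = 0" using null_ball_of_null_point[OF \<phi>] by blast
    \<comment> \<open>The slope \<open>n\<close> is steep enough for the cutoff to reach \<open>1\<close> at \<open>0\<close>.\<close>
    obtain n :: nat where n: "1 < real n * e" using reals_Archimedean3[OF e(1)] by blast
    let ?g = "cutoff n e :: 'a \<Rightarrow> real"
    have g0: "?g 0 = 1" using n by (simp add: cutoff_def)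
    let ?T = "{\<psi> \<in> counting_measures. (\<integral>x. ?g x \<partial>\<psi>) \<in> {..<1}}"
    have "openin vague_topology ?T" by (rule openin_vague_basic[OF test_function_cutoff]) simp
    moreover have "\<phi> \<in> ?T"
    proof -
      have "AE x in \<phi>. x \<notin> ball 0 e"
        using e(2) by (intro AE_not_in) (simp add: null_sets_def counting_measuresD[OF \<phi>(1)])
      then have "AE x in \<phi>. ?g x = 0"
        by eventually_elim (simp add: cutoff_eq_0)
      then have "(\<integral>x. ?g x \<partial>\<phi>) = 0" by (rule integral_eq_zero_AE)
      then show ?thesis using \<phi>(1) by simp
    qed
    moreover have "?T \<subseteq> counting_measures - counting_measures0"
    proof
      fix \<psi> assume "\<psi> \<in> ?T"
      then have \<psi>: "\<psi> \<in> counting_measures" "(\<integral>x. ?g x \<partial>\<psi>) < 1" by auto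
      note C = counting_measuresD[OF \<psi>(1)]
      have i0: "integrable \<psi> (indicator {0} :: 'a \<Rightarrow> real)" using C(4)[of "{0}"] by (simp add: C)
      have "(\<integral>x. indicator {0} x \<partial>\<psi>) \<le> (\<integral>x. ?g x \<partial>\<psi>)"
        by (rule integral_mono[OF i0 test_function_integrable[OF \<psi>(1) test_function_cutoff]])
          (use g0 cutoff_bounds(1) in \<open>auto simp: indicator_def\<close>)
      then have lt: "measure \<psi> {0} < 1" using \<psi>(2) by (simp add: C)
      obtain k :: nat where k: "emeasure \<psi> {0} = of_nat k" using C(3)[of "{0}"] by auto
      then have "measure \<psi> {0} = real k" by (simp add: measure_def)
      then have "k = 0" using lt by simp
      then show "\<psi> \<in> counting_measures - counting_measures0" using k \<psi>(1) by (simp add: counting_measures0_def)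
    qed
    ultimately show "\<exists>T. openin vague_topology T \<and> \<phi> \<in> T \<and> T \<subseteq> counting_measures - counting_measures0"
      by blast
  qed
qed

lemma counting_measures0_borel:
  "(counting_measures0 :: 'a::euclidean_space measure set) \<in> sets (borel_of vague_topology)"
proof -
  have "openin vague_topology (counting_measures - counting_measures0 :: 'a measure set)"
    using closedin_counting_measures0 unfolding closedin_def topspace_vague_topology by blast
  from sets.compl_sets[OF openin_sets_borel_of[OF this]]
  show ?thesis
    by (simp add: topspace_vague_topology double_diff[OF counting_measures0_subset order_refl])
qed

lemma sets_borel_of_vague_topology0:
  "sets (borel_of vague_topology0) =
    (\<inter>) counting_measures0 ` sets (borel_of (vague_topology :: 'a::euclidean_space measure topology))"
proof -
  let ?V = "vague_topology :: 'a measure topology"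
  have "(\<inter>) counting_measures0 ` sets (borel_of ?V)
      = sigma_sets counting_measures0 ((\<inter>) counting_measures0 ` {U. openin ?V U})"
    unfolding sets_borel_of topspace_vague_topology
  proof (rule sigma_sets_Int)
    show "counting_measures0 \<in> sigma_sets counting_measures {U. openin ?V U}"
      using counting_measures0_borel unfolding sets_borel_of topspace_vague_topology .
  qed (rule counting_measures0_subset)
  also have "(\<inter>) counting_measures0 ` {U. openin ?V U} = {U. openin vague_topology0 U}"
    by (auto simp: vague_topology0_def openin_subtopology)
  finally show ?thesis by (simp add: sets_borel_of topspace_vague_topology0)
qed

text \<open>\<open>K\<close> is the image of the parameters with at most \<open>r k\<close> slots in use in the \<open>k\<close>-th annulus, a product
  of compact sets, intersected with the closed set of configurations with a point at \<open>0\<close>.\<close>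
lemma compactin_bounded_configs:
  fixes r :: "nat \<Rightarrow> nat"
  obtains K :: "'a::euclidean_space measure set" where "compactin vague_topology0 K"
    "\<And>\<phi>. \<phi> \<in> counting_measures0 \<Longrightarrow> (\<And>k. emeasure \<phi> (ball 0 (real k + 1)) \<le> of_nat (r k)) \<Longrightarrow> \<phi> \<in> K"
proof -
  let ?X = "PiE UNIV (\<lambda>s. annulus (fst s)) :: (nat \<times> nat \<Rightarrow> 'a) set"
  let ?R = "PiE UNIV (\<lambda>k. {..r k}) :: (nat \<Rightarrow> nat) set"
  have an: "compact (annulus k :: 'a set)" for k
  proof -
    have "annulus k = cball 0 (real k + 1) - ball (0::'a) (real k)" by (auto simp: annulus_def)
    then show ?thesis by (simp add: compact_diff)
  qed
  have "compactin (product_topology (\<lambda>_. euclidean) UNIV) ?X"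
    unfolding compactin_PiE by (simp add: an)
  then have X: "compact ?X" by (simp add: euclidean_product_topology)
  have "compactin (product_topology (\<lambda>_. euclidean) UNIV) ?R"
    unfolding compactin_PiE by (simp add: finite_imp_compact)
  then have R: "compact ?R" by (simp add: euclidean_product_topology)
  have sub: "?X \<times> ?R \<subseteq> params" by (auto simp: params_def PiE_iff)
  have "compactin (top_of_set params) (?X \<times> ?R)"
    using compact_Times[OF X R] sub by (simp add: compactin_subtopology)
  then have "compactin vague_topology (config ` (?X \<times> ?R))"
    by (rule image_compactin[OF _ continuous_config])
  then have "compactin vague_topology (counting_measures0 \<inter> config ` (?X \<times> ?R))"
    by (rule closed_Int_compactin[OF closedin_counting_measures0])
  then have "compactin vague_topology0 (counting_measures0 \<inter> config ` (?X \<times> ?R))"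
    by (simp add: vague_topology0_def compactin_subtopology)
  moreover have "\<phi> \<in> counting_measures0 \<inter> config ` (?X \<times> ?R)"
    if \<phi>: "\<phi> \<in> counting_measures0" "\<And>k. emeasure \<phi> (ball 0 (real k + 1)) \<le> of_nat (r k)" for \<phi>
  proof -
    obtain p where p: "p \<in> params" "config p = \<phi>" "\<And>k. of_nat (snd p k) \<le> emeasure \<phi> (ball 0 (real k + 1))"
      using config_surj[of \<phi>] \<phi>(1) counting_measures0_subset by blast
    have "snd p k \<le> r k" for k
    proof -
      have "(of_nat (snd p k) :: ennreal) \<le> of_nat (r k)" using p(3) \<phi>(2) by (rule order_trans)
      then show ?thesis by (simp only: of_nat_le_iff)
    qed
    then have "p \<in> ?X \<times> ?R" using p(1) by (cases p) (auto simp: params_def PiE_iff)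
    then show ?thesis using p(2) \<phi>(1) by blast
  qed
  ultimately show ?thesis using that by blast
qed

section \<open>Translations\<close>

lemma translation_measurable:
  assumes "\<phi> \<in> counting_measures"
  shows "(\<lambda>x. x - t) \<in> measurable \<phi> borel"
proof -
  have "(\<lambda>x. x - t) \<in> measurable borel borel" by simp
  then show ?thesis
    using measurable_cong_sets[OF counting_measuresD(1)[OF assms] refl] by blast
qed

lemma emeasure_shift:
  assumes "\<phi> \<in> counting_measures" "B \<in> sets borel"
  shows "emeasure (shift t \<phi>) B = emeasure \<phi> ((\<lambda>x. x - t) -` B)"
  unfolding shift_def
  using emeasure_distr[OF translation_measurable[OF assms(1)] assms(2)] counting_measuresD(2)[OF assms(1)]
  by simp

lemma shift_counting:
  fixes \<phi> :: "'a::euclidean_space measure"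
  assumes \<phi>: "\<phi> \<in> counting_measures"
  shows "shift t \<phi> \<in> counting_measures"
proof -
  have "\<exists>k::nat. emeasure (shift t \<phi>) B = of_nat k" if B: "B \<in> sets borel" "bounded B" for B
  proof -
    have "(\<lambda>x. x - t) -` B = (+) t ` B" by (auto simp: image_iff intro!: bexI[of _ "_ - t"])
    then have "bounded ((\<lambda>x. x - t) -` B)" using B(2) by (simp add: bounded_translation)
    moreover have "(\<lambda>x. x - t) -` B \<in> sets borel"
      using measurable_sets[of "\<lambda>x. x - t" borel borel B] B by simp
    ultimately show ?thesis using counting_measuresD(3)[OF \<phi>] by (simp add: emeasure_shift[OF \<phi> B(1)])
  qed
  then show ?thesis by (simp add: counting_measures_def shift_def)
qed

lemma integral_shift:
  fixes g :: "'a::euclidean_space \<Rightarrow> real"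
  assumes "\<phi> \<in> counting_measures" "test_function g"
  shows "(\<integral>x. g x \<partial>shift t \<phi>) = (\<integral>x. g (x - t) \<partial>\<phi>)"
  unfolding shift_def
  by (rule integral_distr[OF translation_measurable[OF assms(1)] test_function_borel[OF assms(2)]])

lemma test_function_translate:
  fixes g :: "'a::euclidean_space \<Rightarrow> real"
  assumes g: "test_function g"
  shows "test_function (\<lambda>x. g (x - t))"
proof -
  obtain m :: nat and c where m: "\<And>x. real m \<le> norm x \<Longrightarrow> g x = 0" "\<And>x. \<bar>g x\<bar> \<le> c"
    using test_functionE[OF g] by blast
  have gc: "continuous_on UNIV g" using g by (simp add: test_function_def)
  show ?thesis
  proof (rule test_functionI[where R="real m + norm t"])
    show "continuous_on UNIV (\<lambda>x. g (x - t))"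
      by (rule continuous_on_compose2[OF gc]) (auto intro: continuous_intros)
    fix x :: 'a assume "real m + norm t \<le> norm x"
    then have "real m \<le> norm (x - t)" using norm_triangle_ineq2[of x t] by simp
    then show "g (x - t) = 0" by (rule m(1))
  qed
qed

lemma shift_in_counting_measures0_iff:
  fixes \<phi> :: "'a::euclidean_space measure" and t :: 'a
  assumes "\<phi> \<in> counting_measures"
  shows "shift t \<phi> \<in> counting_measures0 \<longleftrightarrow> 0 < emeasure \<phi> {t}"
proof -
  have "(\<lambda>x :: 'a. x - t) -` {0} = {t}" by auto
  then show ?thesis
    using assms by (simp add: counting_measures0_def shift_counting emeasure_shift)
qed

lemma support_atom:
  assumes \<phi>: "\<phi> \<in> counting_measures" and x: "x \<in> support \<phi>"
  shows "0 < emeasure \<phi> {x}"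
proof (rule ccontr)
  assume "\<not> 0 < emeasure \<phi> {x}"
  then have "emeasure \<phi> {x} = 0" by (simp add: zero_less_iff_neq_zero)
  from null_ball_of_null_point[OF \<phi> this] obtain e where e: "e > 0" "emeasure \<phi> (ball x e) = 0" by blast
  have "0 < emeasure \<phi> (ball x e)" using x e(1) unfolding support_def by simp
  then show False using e(2) by simp
qed

text \<open>The non-atoms form an open set, since a null point has a null ball around it.\<close>
lemma AE_atom:
  fixes \<phi> :: "'a::euclidean_space measure"
  assumes \<phi>: "\<phi> \<in> counting_measures"
  shows "AE t in \<phi>. 0 < emeasure \<phi> {t}"
proof -
  let ?D = "{t. emeasure \<phi> {t} = 0}"
  have "open ?D"
    unfolding open_contains_ball
  proof
    fix t assume "t \<in> ?D"
    then obtain e where e: "e > 0" "emeasure \<phi> (ball t e) = 0"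
      using null_ball_of_null_point[OF \<phi>] by blast
    have "emeasure \<phi> {y} = 0" if "y \<in> ball t e" for y
      using emeasure_mono[of "{y}" "ball t e" \<phi>] that e(2) by (simp add: counting_measuresD[OF \<phi>])
    then show "\<exists>e>0. ball t e \<subseteq> ?D" using e(1) by blast
  qed
  then have D: "?D \<in> sets borel" by simp
  have "emeasure \<phi> ?D = 0" by (rule counting_measure_null_if_no_atoms[OF \<phi> D]) simp
  then have "AE t in \<phi>. t \<notin> ?D"
    using D by (intro AE_not_in) (simp add: null_sets_def counting_measuresD[OF \<phi>])
  then show ?thesis by eventually_elim (simp add: zero_less_iff_neq_zero)
qed

section \<open>Point-shifts\<close>

lemma point_map_shift_in:
  assumes "point_map f" "\<phi> \<in> counting_measures0"
  shows "point_map_shift f \<phi> \<in> counting_measures0"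
proof -
  have \<phi>: "\<phi> \<in> counting_measures" using assms(2) counting_measures0_subset by blast
  have "f \<phi> \<in> support \<phi>" using assms unfolding point_map_def by blast
  from support_atom[OF \<phi> this] show ?thesis
    by (simp add: point_map_shift_def shift_in_counting_measures0_iff[OF \<phi>])
qed

text \<open>Dominated convergence: as the translations stay bounded, all translates of \<open>g\<close> are supported in
  one ball, which has finite mass.\<close>
lemma translated_integral_tendsto:
  fixes g :: "'a::euclidean_space \<Rightarrow> real"
  assumes \<phi>: "\<phi> \<in> counting_measures" and g: "test_function g"
    and t: "t \<longlonglongrightarrow> l" and bd: "\<And>i::nat. norm (t i) \<le> b"
  shows "(\<lambda>i. \<integral>x. g (x - t i) \<partial>\<phi>) \<longlonglongrightarrow> (\<integral>x. g (x - l) \<partial>\<phi>)"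
proof -
  note C = counting_measuresD[OF \<phi>]
  obtain m :: nat and c where m: "\<And>x. real m \<le> norm x \<Longrightarrow> g x = 0" "\<And>x. \<bar>g x\<bar> \<le> c"
    using test_functionE[OF g] by blast
  have gc: "continuous_on UNIV g" using g by (simp add: test_function_def)
  let ?B = "ball (0::'a) (real m + b)"
  show ?thesis
  proof (rule integral_dominated_convergence[where w="\<lambda>x. c * indicator ?B x"])
    show "(\<lambda>x. g (x - l)) \<in> borel_measurable \<phi>" "\<And>i. (\<lambda>x. g (x - t i)) \<in> borel_measurable \<phi>"
      using test_function_integrable[OF \<phi> test_function_translate[OF g]] by blast+
    show "integrable \<phi> (\<lambda>x. c * indicator ?B x)"
      using C(4)[of ?B] by (simp add: C)
    show "AE x in \<phi>. (\<lambda>i. g (x - t i)) \<longlonglongrightarrow> g (x - l)"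
    proof (rule AE_I2)
      fix x
      have "isCont g (x - l)" using gc by (simp add: continuous_on_eq_continuous_at)
      then show "(\<lambda>i. g (x - t i)) \<longlonglongrightarrow> g (x - l)"
        by (rule isCont_tendsto_compose) (intro tendsto_diff tendsto_const t)
    qed
    show "AE x in \<phi>. norm (g (x - t i)) \<le> c * indicator ?B x" for i
    proof (rule AE_I2)
      fix x
      show "norm (g (x - t i)) \<le> c * indicator ?B x"
      proof (cases "x \<in> ?B")
        case True
        then show ?thesis using m(2) by simp
      next
        case False
        then have "real m + b \<le> norm x" by simp
        then have "real m \<le> norm (x - t i)" using norm_triangle_ineq2[of x "t i"] bd[of i] by simp
        then show ?thesis using False m(1) by simp
      qed
    qed
  qed
qed

text \<open>For a fixed \<open>t\<close> the integral of \<open>g (x - t)\<close> is a measurable function of \<open>\<phi>\<close>, hence so it is with a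
  simple function of \<open>\<phi>\<close> in place of \<open>t\<close>. Simple functions approximate \<open>f\<close>, and the integral is
  continuous in \<open>t\<close>.\<close>
lemma point_map_shift_measurable:
  fixes f :: "'a::euclidean_space measure \<Rightarrow> 'a"
  assumes f: "point_map f"
  shows "point_map_shift f \<in> measurable (borel_of vague_topology0) (borel_of vague_topology0)"
proof (rule measurable_vague0I)
  let ?M = "borel_of (vague_topology0 :: 'a measure topology)"
  show "point_map_shift f \<phi> \<in> counting_measures0" if "\<phi> \<in> space ?M" for \<phi>
    using that point_map_shift_in[OF f] by (simp add: topspace_vague_topology0)
  fix g :: "'a \<Rightarrow> real" assume g: "test_function g"
  have N: "\<phi> \<in> counting_measures" if "\<phi> \<in> space ?M" for \<phi>
    using that counting_measures0_subset by (auto simp: topspace_vague_topology0)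
  have "f \<in> measurable ?M borel" using f by (simp add: point_map_def)
  from borel_measurable_implies_sequence_metric[OF this, of 0]
  obtain F where F: "\<And>i. simple_function ?M (F i)"
    "\<And>\<phi>. \<phi> \<in> space ?M \<Longrightarrow> (\<lambda>i. F i \<phi>) \<longlonglongrightarrow> f \<phi>"
    "\<And>i \<phi>. \<phi> \<in> space ?M \<Longrightarrow> dist (F i \<phi>) 0 \<le> 2 * dist (f \<phi>) 0" by blast
  show "(\<lambda>\<phi>. \<integral>y. g y \<partial>point_map_shift f \<phi>) \<in> borel_measurable ?M"
  proof (rule borel_measurable_LIMSEQ_real)
    show "(\<lambda>\<phi>. \<integral>x. g (x - F i \<phi>) \<partial>\<phi>) \<in> borel_measurable ?M" for i
    proof (rule measurable_compose_countable'[where I="F i ` space ?M" and g="F i"])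
      show "(\<lambda>\<phi>. \<integral>x. g (x - t) \<partial>\<phi>) \<in> borel_measurable ?M" for t
        by (rule integral_measurable_vague0[OF test_function_translate[OF g]])
      have "finite (F i ` space ?M)" "\<And>x. x \<in> F i ` space ?M \<Longrightarrow> F i -` {x} \<inter> space ?M \<in> sets ?M"
        using F(1)[of i] unfolding simple_function_def by blast+
      then show "F i \<in> measurable ?M (count_space (F i ` space ?M))"
        by (subst measurable_count_space_eq2) auto
      show "countable (F i ` space ?M)"
        using F(1)[of i] by (simp add: simple_function_def countable_finite)
    qed
    fix \<phi> assume \<phi>: "\<phi> \<in> space ?M"
    have "(\<lambda>i. \<integral>x. g (x - F i \<phi>) \<partial>\<phi>) \<longlonglongrightarrow> (\<integral>x. g (x - f \<phi>) \<partial>\<phi>)"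
      by (rule translated_integral_tendsto[OF N[OF \<phi>] g F(2)[OF \<phi>], of "2 * dist (f \<phi>) 0"])
        (use F(3)[OF \<phi>] in simp)
    then show "(\<lambda>i. \<integral>x. g (x - F i \<phi>) \<partial>\<phi>) \<longlonglongrightarrow> (\<integral>y. g y \<partial>point_map_shift f \<phi>)"
      by (simp add: point_map_shift_def integral_shift[OF N[OF \<phi>] g])
  qed
qed

section \<open>The Palm distribution\<close>

lemma palm_probability_unit_cube:
  fixes P Q :: "'w measure" and \<theta> :: "'a::euclidean_space \<Rightarrow> 'w \<Rightarrow> 'w" and \<Phi> :: "'w \<Rightarrow> 'a measure"
  assumes Q: "palm_probability P \<theta> \<Phi> Q" and A: "A \<in> sets P"
  shows "emeasure Q A =
    (\<integral>\<^sup>+\<omega>. (\<integral>\<^sup>+t\<in>cbox 0 One. indicator A (\<theta> t \<omega>) \<partial>\<Phi> \<omega>) \<partial>P) / intensity P \<Phi>"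
proof -
  have lb: "emeasure lborel (cbox 0 One :: 'a set) = 1"
    by (subst emeasure_lborel_cbox) simp_all
  have "emeasure Q A = (\<integral>\<^sup>+\<omega>. (\<integral>\<^sup>+t\<in>B. indicator A (\<theta> t \<omega>) \<partial>\<Phi> \<omega>) \<partial>P) /
      (intensity P \<Phi> * emeasure lborel B)"
    if "B \<in> sets borel" "0 < emeasure lborel B \<and> emeasure lborel B < \<infinity>" for B :: "'a set"
    using Q A that unfolding palm_probability_def by blast
  from this[of "cbox 0 One"] show ?thesis by (simp add: lb)
qed

lemma palm_probability_prob_space:
  fixes P Q :: "'w measure" and \<theta> :: "'a::euclidean_space \<Rightarrow> 'w \<Rightarrow> 'w" and \<Phi> :: "'w \<Rightarrow> 'a measure"
  assumes spp: "stationary_point_process P \<theta> \<Phi>" and pos: "0 < intensity P \<Phi>" and fin: "intensity P \<Phi> < \<infinity>"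
    and Q: "palm_probability P \<theta> \<Phi> Q"
  shows "prob_space Q"
proof
  interpret stationary_point_process P \<theta> \<Phi> by fact
  have sQ: "sets Q = sets P" using Q by (simp add: palm_probability_def)
  have \<theta>: "\<theta> t \<omega> \<in> space P" if "\<omega> \<in> space P" for t \<omega>
    using measurable_space[OF flow_measurable, of "(t, \<omega>)"] that by (simp add: space_pair_measure)
  have "emeasure Q (space P) =
      (\<integral>\<^sup>+\<omega>. (\<integral>\<^sup>+t\<in>cbox 0 One. indicator (space P) (\<theta> t \<omega>) \<partial>\<Phi> \<omega>) \<partial>P) / intensity P \<Phi>"
    by (rule palm_probability_unit_cube[OF Q sets.top])
  also have "(\<integral>\<^sup>+\<omega>. (\<integral>\<^sup>+t\<in>cbox 0 One. indicator (space P) (\<theta> t \<omega>) \<partial>\<Phi> \<omega>) \<partial>P) = intensity P \<Phi>"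
    unfolding intensity_def
  proof (rule nn_integral_cong)
    fix \<omega> assume \<omega>: "\<omega> \<in> space P"
    then have "\<Phi> \<omega> \<in> counting_measures"
      using measurable_space[OF process_measurable] by (simp add: topspace_vague_topology)
    then show "(\<integral>\<^sup>+t\<in>cbox 0 One. indicator (space P) (\<theta> t \<omega>) \<partial>\<Phi> \<omega>) = emeasure (\<Phi> \<omega>) (cbox 0 One)"
      using \<theta>[OF \<omega>] counting_measuresD(1)[of "\<Phi> \<omega>"] by simp
  qed
  also have "intensity P \<Phi> / intensity P \<Phi> = 1"
    using pos fin by (simp add: zero_less_iff_neq_zero)
  finally show "emeasure Q (space Q) = 1" using sets_eq_imp_space_eq[OF sQ] by simp
qed

text \<open>\<open>\<Phi> (\<theta> t \<omega>)\<close> is \<open>\<Phi> \<omega>\<close> translated by \<open>- t\<close>, so it has a point at \<open>0\<close> whenever \<open>t\<close> is an atom of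
  \<open>\<Phi> \<omega>\<close>, and the Palm formula integrates over \<open>t\<close> against \<open>\<Phi> \<omega>\<close>.\<close>
lemma palm_probability_point_at_origin:
  fixes P Q :: "'w measure" and \<theta> :: "'a::euclidean_space \<Rightarrow> 'w \<Rightarrow> 'w" and \<Phi> :: "'w \<Rightarrow> 'a measure"
  assumes spp: "stationary_point_process P \<theta> \<Phi>"
    and Q: "palm_probability P \<theta> \<Phi> Q"
  shows "emeasure Q {\<omega> \<in> space P. \<Phi> \<omega> \<notin> counting_measures0} = 0"
proof -
  interpret stationary_point_process P \<theta> \<Phi> by fact
  have \<theta>: "\<theta> t \<omega> \<in> space P" if "\<omega> \<in> space P" for t \<omega>
    using measurable_space[OF flow_measurable, of "(t, \<omega>)"] that by (simp add: space_pair_measure)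
  let ?A = "{\<omega> \<in> space P. \<Phi> \<omega> \<notin> counting_measures0}"
  have "?A = space P - \<Phi> -` counting_measures0 \<inter> space P" by auto
  also have "\<dots> \<in> sets P"
    by (intro sets.Diff sets.top measurable_sets[OF process_measurable] counting_measures0_borel)
  finally have "emeasure Q ?A =
      (\<integral>\<^sup>+\<omega>. (\<integral>\<^sup>+t\<in>cbox 0 One. indicator ?A (\<theta> t \<omega>) \<partial>\<Phi> \<omega>) \<partial>P) / intensity P \<Phi>"
    by (rule palm_probability_unit_cube[OF Q])
  also have "(\<integral>\<^sup>+\<omega>. (\<integral>\<^sup>+t\<in>cbox 0 One. indicator ?A (\<theta> t \<omega>) \<partial>\<Phi> \<omega>) \<partial>P) = (\<integral>\<^sup>+\<omega>. 0 \<partial>P)"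
  proof (rule nn_integral_cong)
    fix \<omega> assume \<omega>: "\<omega> \<in> space P"
    then have \<phi>: "\<Phi> \<omega> \<in> counting_measures"
      using measurable_space[OF process_measurable] by (simp add: topspace_vague_topology)
    have "AE t in \<Phi> \<omega>. indicator ?A (\<theta> t \<omega>) * indicator (cbox 0 One) t = (0 :: ennreal)"
      using AE_atom[OF \<phi>]
    proof eventually_elim
      case (elim t)
      then have "\<Phi> (\<theta> t \<omega>) \<in> counting_measures0"
        by (simp add: process_covariant[OF \<omega>] shift_in_counting_measures0_iff[OF \<phi>])
      then show ?case by simp
    qed
    from nn_integral_cong_AE[OF this]
    show "(\<integral>\<^sup>+t\<in>cbox 0 One. indicator ?A (\<theta> t \<omega>) \<partial>\<Phi> \<omega>) = 0" by simp
  qed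
  finally show ?thesis by simp
qed

lemma palm_distribution_prob_measure:
  fixes P Q :: "'w measure" and \<theta> :: "'a::euclidean_space \<Rightarrow> 'w \<Rightarrow> 'w" and \<Phi> :: "'w \<Rightarrow> 'a measure"
  assumes spp: "stationary_point_process P \<theta> \<Phi>" and pos: "0 < intensity P \<Phi>" and fin: "intensity P \<Phi> < \<infinity>"
    and Q: "palm_probability P \<theta> \<Phi> Q"
  shows "palm_distribution \<Phi> Q \<in> prob_measures vague_topology0"
proof -
  interpret stationary_point_process P \<theta> \<Phi> by fact
  interpret Q: prob_space Q by (rule palm_probability_prob_space[OF assms])
  have sQ: "sets Q = sets P" using Q by (simp add: palm_probability_def)
  note spQ = sets_eq_imp_space_eq[OF sQ]
  have \<Phi>Q: "\<Phi> \<in> measurable Q (borel_of vague_topology)"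
    using process_measurable measurable_cong_sets[OF sQ refl] by blast
  let ?D = "distr Q (borel_of vague_topology) \<Phi>"
  have sets: "sets (palm_distribution \<Phi> Q) = sets (borel_of vague_topology0)"
    by (simp add: palm_distribution_def sets_restrict_space sets_borel_of_vague_topology0)
  have sp: "space (palm_distribution \<Phi> Q) = counting_measures0"
    using sets_eq_imp_space_eq[OF sets] by (simp add: topspace_vague_topology0)
  have N0: "\<Phi> -` counting_measures0 \<inter> space Q \<in> sets Q"
    by (rule measurable_sets[OF \<Phi>Q counting_measures0_borel])
  have "emeasure (palm_distribution \<Phi> Q) counting_measures0 = emeasure ?D counting_measures0"
    unfolding palm_distribution_def
    by (intro emeasure_restrict_space order_refl)
      (simp add: topspace_vague_topology Int_absorb2[OF counting_measures0_subset] counting_measures0_borel)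
  also have "\<dots> = emeasure Q (\<Phi> -` counting_measures0 \<inter> space Q)"
    by (rule emeasure_distr[OF \<Phi>Q counting_measures0_borel])
  also have "\<dots> = 1"
  proof (rule Q.emeasure_eq_1_AE[OF N0])
    have "AE \<omega> in Q. \<omega> \<notin> {\<omega> \<in> space P. \<Phi> \<omega> \<notin> counting_measures0}"
    proof (rule AE_not_in)
      have "{\<omega> \<in> space P. \<Phi> \<omega> \<notin> counting_measures0} = space Q - \<Phi> -` counting_measures0 \<inter> space Q"
        by (auto simp: spQ)
      then have "{\<omega> \<in> space P. \<Phi> \<omega> \<notin> counting_measures0} \<in> sets Q" using N0 by simp
      then show "{\<omega> \<in> space P. \<Phi> \<omega> \<notin> counting_measures0} \<in> null_sets Q"
        using palm_probability_point_at_origin[OF spp Q] by (simp add: null_sets_def)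
    qed
    then show "AE \<omega> in Q. \<omega> \<in> \<Phi> -` counting_measures0 \<inter> space Q"
      using AE_space by eventually_elim (simp add: spQ)
  qed
  finally have "prob_space (palm_distribution \<Phi> Q)" by (intro prob_spaceI) (simp add: sp)
  then show ?thesis using sets by (simp add: prob_measures_def)
qed

lemma iterated_law_prob_measure:
  fixes f :: "'a::euclidean_space measure \<Rightarrow> 'a"
  assumes f: "point_map f" and P0: "P0 \<in> prob_measures vague_topology0"
  shows "iterated_law f P0 n \<in> prob_measures vague_topology0"
proof -
  let ?M = "borel_of (vague_topology0 :: 'a measure topology)"
  have "point_map_shift f ^^ n \<in> measurable ?M ?M"
  proof (induction n)
    case (Suc n)
    then show ?case using point_map_shift_measurable[OF f] by (simp add: measurable_comp)
  qed simp
  then have "point_map_shift f ^^ n \<in> measurable P0 ?M"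
    using measurable_cong_sets[OF prob_measures_D(1)[OF P0] refl] by blast
  then have "prob_space (iterated_law f P0 n)"
    unfolding iterated_law_def by (rule prob_space.prob_space_distr[OF prob_measures_D(3)[OF P0]])
  then show ?thesis by (simp add: prob_measures_def iterated_law_def)
qed

section \<open>Tightness of the point counts\<close>

lemma tendsto_0_ennrealI:
  fixes F :: "'b \<Rightarrow> ennreal"
  assumes "\<And>e. 0 < e \<Longrightarrow> eventually (\<lambda>x. F x \<le> ennreal e) net"
  shows "(F \<longlongrightarrow> 0) net"
proof (rule order_tendstoI)
  fix a :: ennreal assume "0 < a"
  then obtain b where b: "0 < b" "b < a" using dense by blast
  then obtain e where e: "b = ennreal e" "0 < e" by (cases b) (auto simp: top_unique)
  show "eventually (\<lambda>x. F x < a) net"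
    using assms[OF e(2)] by (rule eventually_mono) (use b(2) e(1) in simp)
qed (simp add: not_less_zero)

lemma measurable_ball_count_superlevel:
  "{\<phi> \<in> counting_measures0. s < measure \<phi> (ball (0::'a::euclidean_space) R)} \<in> sets (borel_of vague_topology0)"
proof -
  have "(\<lambda>\<phi>. measure \<phi> (ball (0::'a) R)) -` {s<..} \<inter> space (borel_of vague_topology0) \<in> sets (borel_of vague_topology0)"
    by (rule measurable_sets[OF measure_ball_measurable_vague0]) simp
  moreover have "(\<lambda>\<phi>. measure \<phi> (ball (0::'a) R)) -` {s<..} \<inter> space (borel_of vague_topology0)
      = {\<phi> \<in> counting_measures0. s < measure \<phi> (ball 0 R)}"
    by (auto simp: topspace_vague_topology0)
  ultimately show ?thesis by simp
qed

lemma count_gt_iff: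
  assumes "\<phi> \<in> counting_measures" "B \<in> sets borel" "bounded B" "0 \<le> s"
  shows "ennreal s < emeasure \<phi> B \<longleftrightarrow> s < measure \<phi> B"
proof -
  have "emeasure \<phi> B = ennreal (measure \<phi> B)"
    using counting_measuresD(4)[OF assms(1-3)] by (intro emeasure_eq_ennreal_measure) auto
  then show ?thesis using assms(4) by (simp add: ennreal_less_iff)
qed

lemma single_law_tight:
  fixes R :: real
  assumes \<mu>: "\<mu> \<in> prob_measures (vague_topology0 :: 'a::euclidean_space measure topology)" and e: "0 < e"
  shows "\<exists>s::nat. emeasure \<mu> {\<phi> \<in> counting_measures0. real s < measure \<phi> (ball (0::'a) R)} < e"
proof -
  interpret prob_space \<mu> by (rule prob_measures_D(3)[OF \<mu>])
  let ?S = "\<lambda>s::nat. {\<phi> \<in> counting_measures0. real s < measure \<phi> (ball (0::'a) R)}"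
  have "(\<lambda>s. emeasure \<mu> (?S s)) \<longlonglongrightarrow> emeasure \<mu> (\<Inter>s. ?S s)"
  proof (rule Lim_emeasure_decseq)
    show "range ?S \<subseteq> sets \<mu>"
      using measurable_ball_count_superlevel prob_measures_D(1)[OF \<mu>] by blast
    show "decseq ?S" by (rule decseq_SucI) auto
  qed simp
  moreover have "(\<Inter>s. ?S s) = {}"
  proof -
    have "\<exists>s::nat. \<not> real s < measure \<phi> (ball (0::'a) R)" for \<phi>
      using reals_Archimedean2[of "measure \<phi> (ball (0::'a) R)"] by (auto simp: not_less intro: less_imp_le)
    then show ?thesis by blast
  qed
  ultimately have "(\<lambda>s. emeasure \<mu> (?S s)) \<longlonglongrightarrow> 0" by simp
  from order_tendstoD(2)[OF this e] show ?thesis by (auto simp: eventually_sequentially)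
qed

text \<open>The condition controls all but finitely many \<open>n\<close>, and each of the remaining laws is tight by
  itself.\<close>
lemma limsup_imp_uniformly_tight_counts:
  fixes p :: "nat \<Rightarrow> 'a::euclidean_space measure measure"
  assumes p: "\<And>n. p n \<in> prob_measures vague_topology0"
    and lim: "((\<lambda>r::real. limsup (\<lambda>n. emeasure (p n)
          {\<phi> \<in> counting_measures0. emeasure \<phi> (ball 0 R) > ennreal r})) \<longlongrightarrow> 0) at_top"
    and e: "0 < e"
  shows "\<exists>s::nat. \<forall>n. emeasure (p n) {\<phi> \<in> counting_measures0. real s < measure \<phi> (ball (0::'a) R)} \<le> e"
proof -
  let ?S = "\<lambda>s::nat. {\<phi> \<in> counting_measures0. real s < measure \<phi> (ball (0::'a) R)}"
  have eq: "{\<phi> \<in> counting_measures0. emeasure \<phi> (ball (0::'a) R) > ennreal (real s)} = ?S s" for s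
    using count_gt_iff[of _ "ball (0::'a) R" "real s"] counting_measures0_subset by auto
  from order_tendstoD(2)[OF lim e] obtain r where r: "\<And>x. x \<ge> r \<Longrightarrow>
      limsup (\<lambda>n. emeasure (p n) {\<phi> \<in> counting_measures0. emeasure \<phi> (ball (0::'a) R) > ennreal x}) < e"
    unfolding eventually_at_top_linorder by blast
  obtain s0 :: nat where "r < real s0" using reals_Archimedean2 by blast
  then have "limsup (\<lambda>n. emeasure (p n) (?S s0)) < e" using r[of "real s0"] by (simp add: eq)
  from Limsup_lessD[OF this] obtain n0 where n0: "\<And>n. n \<ge> n0 \<Longrightarrow> emeasure (p n) (?S s0) < e"
    by (auto simp: eventually_sequentially)
  have "\<forall>n. \<exists>s. emeasure (p n) (?S s) < e" using single_law_tight[OF p e] by blast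
  from choice[OF this] obtain s where s: "\<And>n. emeasure (p n) (?S (s n)) < e" by blast
  define m where "m = Max (insert s0 (s ` {..<n0}))"
  have anti: "emeasure (p n) (?S m) \<le> emeasure (p n) (?S k)" if "k \<le> m" for k n
  proof (rule emeasure_mono)
    show "?S m \<subseteq> ?S k" using that by auto
    show "?S k \<in> sets (p n)"
      using measurable_ball_count_superlevel prob_measures_D(1)[OF p] by blast
  qed
  have "emeasure (p n) (?S m) \<le> e" for n
  proof (cases "n < n0")
    case True
    then have "s n \<le> m" unfolding m_def by (intro Max_ge) auto
    from anti[OF this, of n] s[of n] show ?thesis by simp
  next
    case False
    have "s0 \<le> m" unfolding m_def by (intro Max_ge) auto
    from anti[OF this, of n] n0[of n] False show ?thesis by simp
  qed
  then show ?thesis by blast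
qed

text \<open>Choose bounds \<open>r k\<close> that the count in the ball of radius \<open>k + 1\<close> exceeds with probability at most
  \<open>e / 2^(k + 1)\<close>. A configuration that respects all of them lies in one compact set.\<close>
lemma tight_counts_imp_relatively_compact:
  fixes p :: "nat \<Rightarrow> 'a::euclidean_space measure measure"
  assumes p: "\<And>n. p n \<in> prob_measures vague_topology0"
    and tight: "\<And>k e. 0 < e \<Longrightarrow> \<exists>s::nat. \<forall>n.
      emeasure (p n) {\<phi> \<in> counting_measures0. real s < measure \<phi> (ball (0::'a) (real k + 1))} \<le> e"
  shows "relatively_compactin (weak_topology vague_topology0) (range p)"
proof (rule tight_imp_relatively_compact[OF cozero_space_vague_topology0])
  show "range p \<subseteq> prob_measures vague_topology0" using p by blast
  fix e :: real assume e: "0 < e"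
  let ?S = "\<lambda>k (s::nat). {\<phi> \<in> counting_measures0. real s < measure \<phi> (ball (0::'a) (real k + 1))}"
  have "\<forall>k::nat. \<exists>s::nat. \<forall>n. emeasure (p n) (?S k s) \<le> ennreal (e * (1/2) ^ Suc k)"
    using tight e by simp
  from choice[OF this] obtain r where
    r: "\<And>k n. emeasure (p n) (?S k (r k)) \<le> ennreal (e * (1/2) ^ Suc k)" by blast
  obtain K :: "'a measure set" where K: "compactin vague_topology0 K"
    "\<And>\<phi>. \<phi> \<in> counting_measures0 \<Longrightarrow> (\<And>k. emeasure \<phi> (ball 0 (real k + 1)) \<le> of_nat (r k)) \<Longrightarrow> \<phi> \<in> K"
    using compactin_bounded_configs by blast
  let ?V = "\<Union>k. ?S k (r k)"
  have V: "?V \<in> sets (borel_of vague_topology0)"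
    by (intro sets.countable_UN) (use measurable_ball_count_superlevel in blast)
  have cover: "topspace vague_topology0 \<subseteq> K \<union> ?V"
    unfolding topspace_vague_topology0
  proof
    fix \<phi> :: "'a measure" assume \<phi>: "\<phi> \<in> counting_measures0"
    show "\<phi> \<in> K \<union> ?V"
    proof (cases "\<phi> \<in> ?V")
      case False
      have "emeasure \<phi> (ball 0 (real k + 1)) \<le> of_nat (r k)" for k
      proof -
        have "\<not> real (r k) < measure \<phi> (ball 0 (real k + 1))" using False \<phi> by blast
        then have "\<not> ennreal (real (r k)) < emeasure \<phi> (ball 0 (real k + 1))"
          using count_gt_iff[of \<phi> "ball 0 (real k + 1)" "real (r k)"] \<phi> counting_measures0_subset by auto
        then show ?thesis by (simp add: not_less ennreal_of_nat_eq_real_of_nat)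
      qed
      from K(2)[OF \<phi> this] show ?thesis by blast
    qed blast
  qed
  have "measure (p n) ?V \<le> e" for n
  proof -
    interpret prob_space "p n" by (rule prob_measures_D(3)[OF p])
    have "emeasure (p n) ?V \<le> (\<Sum>k. emeasure (p n) (?S k (r k)))"
      by (rule emeasure_subadditive_countably)
        (use measurable_ball_count_superlevel prob_measures_D(1)[OF p] in blast)
    also have "\<dots> \<le> (\<Sum>k. ennreal (e * (1/2) ^ Suc k))"
      by (intro suminf_le r) auto
    also have "\<dots> = ennreal (e * 1)"
      using e by (intro suminf_ennreal_eq sums_mult power_half_series) auto
    finally show ?thesis using e by (simp add: emeasure_eq_measure)
  qed
  then show "\<exists>K V. compactin vague_topology0 K \<and> V \<in> sets (borel_of vague_topology0) \<and>
      topspace vague_topology0 \<subseteq> K \<union> V \<and> (\<forall>\<mu>\<in>range p. measure \<mu> V \<le> e)"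
    using K(1) V cover by (intro exI[of _ K] exI[of _ ?V] conjI) auto
qed

text \<open>The sets \<open>{\<phi>. \<phi> B > r}\<close> are compared with superlevel sets of continuous functions of \<open>\<phi>\<close>, to which
  \<open>relatively_compact_imp_uniform_decreasing\<close> applies. The cutoff of slope \<open>1\<close> and radius \<open>a + 1\<close> is \<open>1\<close> on
  the closed ball of radius \<open>a\<close>, which contains \<open>B\<close>.\<close>
lemma relatively_compact_imp_tight_counts:
  fixes A :: "'a::euclidean_space measure measure set"
  assumes A: "relatively_compactin (weak_topology vague_topology0) A"
    and B: "B \<in> sets borel" "bounded B" and e: "0 < e"
  shows "\<exists>r0::real. \<forall>r\<ge>r0. \<forall>\<mu>\<in>A.
    emeasure \<mu> {\<phi> \<in> counting_measures0. emeasure \<phi> B > ennreal r} \<le> ennreal e"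
proof -
  obtain a where a: "\<And>x. x \<in> B \<Longrightarrow> norm x \<le> a" using B(2) unfolding bounded_iff by blast
  let ?g = "cutoff 1 (a + 1) :: 'a \<Rightarrow> real"
  define h :: "nat \<Rightarrow> 'a measure \<Rightarrow> real" where "h k \<phi> = max 0 (min 1 ((\<integral>x. ?g x \<partial>\<phi>) - real k))" for k \<phi>
  have ge: "measure \<phi> B \<le> (\<integral>x. ?g x \<partial>\<phi>)" if \<phi>: "\<phi> \<in> counting_measures0" for \<phi>
  proof -
    have N: "\<phi> \<in> counting_measures" using \<phi> counting_measures0_subset by blast
    note C = counting_measuresD[OF N]
    have "(\<integral>x. indicator B x \<partial>\<phi>) \<le> (\<integral>x. ?g x \<partial>\<phi>)"
    proof (rule integral_mono)
      show "integrable \<phi> (indicator B :: 'a \<Rightarrow> real)" using C(4)[OF B] B by (simp add: C)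
      show "integrable \<phi> ?g" by (rule test_function_integrable[OF N test_function_cutoff])
      show "indicator B x \<le> ?g x" for x
        using a[of x] by (cases "x \<in> B") (simp_all add: cutoff_def)
    qed
    then show ?thesis using B by (simp add: C)
  qed
  have hC: "h k \<in> bcont vague_topology0" for k
  proof (rule bcontI[where c=1])
    have "continuous_map vague_topology0 euclideanreal (\<lambda>\<phi>. \<integral>x. ?g x \<partial>\<phi>)"
      unfolding vague_topology0_def
      by (rule continuous_map_from_subtopology[OF continuous_integral_vague[OF test_function_cutoff]])
    then show "continuous_map vague_topology0 euclideanreal (h k)"
      unfolding h_def by (intro continuous_map_real_max continuous_map_real_min continuous_map_diff) simp_all
  qed (simp add: h_def)
  have dec: "h (Suc k) \<phi> \<le> h k \<phi>" for k \<phi> by (auto simp: h_def)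
  have lim: "(\<lambda>k. h k \<phi>) \<longlonglongrightarrow> 0" for \<phi>
  proof -
    obtain K :: nat where K: "(\<integral>x. ?g x \<partial>\<phi>) < real K" using reals_Archimedean2 by blast
    have "h k \<phi> = 0" if "k \<ge> K" for k
    proof -
      have "(\<integral>x. ?g x \<partial>\<phi>) - real k \<le> 0" using K that by simp
      then show ?thesis by (simp add: h_def max_def min_def)
    qed
    then have "eventually (\<lambda>k. h k \<phi> = 0) sequentially" by (rule eventually_sequentiallyI)
    then show ?thesis by (rule tendsto_eventually)
  qed
  obtain k where k: "\<And>\<mu>. \<mu> \<in> A \<Longrightarrow> (\<integral>\<phi>. h k \<phi> \<partial>\<mu>) < e"
    using relatively_compact_imp_uniform_decreasing[OF A hC dec lim e] by blast
  have "emeasure \<mu> {\<phi> \<in> counting_measures0. emeasure \<phi> B > ennreal r} \<le> ennreal e"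
    if r: "r \<ge> real k + 1" and "\<mu> \<in> A" for r \<mu>
  proof -
    have \<mu>: "\<mu> \<in> prob_measures vague_topology0"
      using A \<open>\<mu> \<in> A\<close> unfolding relatively_compactin_def topspace_weak_topology by blast
    interpret prob_space \<mu> by (rule prob_measures_D(3)[OF \<mu>])
    have sp: "space \<mu> = counting_measures0"
      using prob_measures_D(2)[OF \<mu>] by (simp add: topspace_vague_topology0)
    note ih = bcont_integrable[OF \<mu> hC]
    let ?S = "{\<phi> \<in> space \<mu>. 1 \<le> h k \<phi>}"
    have S: "?S \<in> sets \<mu>" using borel_measurable_integrable[OF ih[of k]] by measurable
    have "{\<phi> \<in> counting_measures0. emeasure \<phi> B > ennreal r} \<subseteq> ?S"
    proof
      fix \<phi> assume "\<phi> \<in> {\<phi> \<in> counting_measures0. emeasure \<phi> B > ennreal r}"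
      then have \<phi>: "\<phi> \<in> counting_measures0" "ennreal r < emeasure \<phi> B" by auto
      have "r < measure \<phi> B"
        using \<phi> counting_measures0_subset r count_gt_iff[of \<phi> B r] B by auto
      then have "1 \<le> (\<integral>x. ?g x \<partial>\<phi>) - real k" using ge[OF \<phi>(1)] r by linarith
      then show "\<phi> \<in> ?S" using \<phi>(1) by (simp add: sp h_def)
    qed
    then have "emeasure \<mu> {\<phi> \<in> counting_measures0. emeasure \<phi> B > ennreal r} \<le> emeasure \<mu> ?S"
      using S by (rule emeasure_mono)
    also have "emeasure \<mu> ?S = ennreal (measure \<mu> ?S)" by (rule emeasure_eq_measure)
    also have "measure \<mu> ?S = (\<integral>\<phi>. indicator ?S \<phi> \<partial>\<mu>)"
      by (simp only: Bochner_Integration.integral_indicator sets.Int_space_eq2[OF S])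
    also have "\<dots> \<le> (\<integral>\<phi>. h k \<phi> \<partial>\<mu>)"
    proof (rule integral_mono[OF _ ih])
      show "integrable \<mu> (indicator ?S :: _ \<Rightarrow> real)"
        by (rule integrable_const_bound[where B=1, OF _ borel_measurable_indicator[OF S]]) simp
      show "indicator ?S \<phi> \<le> h k \<phi>" for \<phi>
        by (cases "\<phi> \<in> ?S") (simp_all add: h_def)
    qed
    also have "\<dots> \<le> e" using k[OF \<open>\<mu> \<in> A\<close>] by simp
    finally show ?thesis by (simp add: ennreal_leI)
  qed
  then show ?thesis by blast
qed

theorem lemma2p9:
  fixes f :: "'a::euclidean_space measure \<Rightarrow> 'a"
    and P Q :: "'w measure"
    and \<theta> :: "'a \<Rightarrow> 'w \<Rightarrow> 'w"
    and \<Phi> :: "'w \<Rightarrow> 'a measure"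
    and P0 :: "'a measure measure"
  assumes "point_map f"
    and "stationary_point_process P \<theta> \<Phi>"
    and "0 < intensity P \<Phi>" and "intensity P \<Phi> < \<infinity>"
    and "palm_probability P \<theta> \<Phi> Q"
    and "P0 = palm_distribution \<Phi> Q"
  shows "relatively_compactin (weak_topology vague_topology0) (range (iterated_law f P0)) \<longleftrightarrow>
    (\<forall>B\<in>sets borel. bounded B \<longrightarrow>
      ((\<lambda>r::real. limsup (\<lambda>n. emeasure (iterated_law f P0 n)
          {\<phi> \<in> counting_measures0. emeasure \<phi> B > ennreal r})) \<longlongrightarrow> 0) at_top)"
    (is "?compact \<longleftrightarrow> ?tight")
proof
  have P0: "P0 \<in> prob_measures vague_topology0"
    unfolding assms(6) by (rule palm_distribution_prob_measure[OF assms(2-5)])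
  note law = iterated_law_prob_measure[OF assms(1) P0]
  show ?compact if tight: ?tight
  proof (rule tight_counts_imp_relatively_compact[OF law])
    fix k :: nat and e :: ennreal assume e: "0 < e"
    have "ball (0::'a) (real k + 1) \<in> sets borel" "bounded (ball (0::'a) (real k + 1))" by simp_all
    from tight[rule_format, OF this] law e
    show "\<exists>s::nat. \<forall>n. emeasure (iterated_law f P0 n)
        {\<phi> \<in> counting_measures0. real s < measure \<phi> (ball (0::'a) (real k + 1))} \<le> e"
      by (intro limsup_imp_uniformly_tight_counts)
  qed
  show ?tight if compact: ?compact
  proof (intro ballI impI tendsto_0_ennrealI)
    fix B :: "'a set" and e :: real assume B: "B \<in> sets borel" "bounded B" and e: "0 < e"
    obtain r0 where r0: "\<And>r n. r \<ge> r0 \<Longrightarrow> emeasure (iterated_law f P0 n)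
        {\<phi> \<in> counting_measures0. emeasure \<phi> B > ennreal r} \<le> ennreal e"
      using relatively_compact_imp_tight_counts[OF compact B e] by blast
    show "\<forall>\<^sub>F r in at_top. limsup (\<lambda>n. emeasure (iterated_law f P0 n)
        {\<phi> \<in> counting_measures0. emeasure \<phi> B > ennreal r}) \<le> ennreal e"
      using eventually_ge_at_top[of r0] by eventually_elim (intro Limsup_bounded always_eventually allI r0)
  qed
qed

end
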